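(* Let $\Theta\subset\mathbb{R}^n$ be a symmetric set, $C=\{X\in\mathbf{S}^n:\lambda(X)\in\Theta\}$, $X\in C$ and $H\in T_C(X)$. Then $$T^2_C(X,H)=\{W\in\mathbf{S}^n:\ \lambda''(X;H,W)\in T^2_\Theta\big(\lambda(X),\lambda'(X;H)\big)\}.$$ Moreover: (a) if $\Theta$ is parabolically derivable at $\lambda(X)$ for $\lambda'(X;H)$, then $C$ is parabolically derivable at $X$ for $H$; (b) if $C$ is parabolically derivable at $X$ for every $H\in T_C(X)$, then $\Theta$ is parabolically derivable at $\lambda(X)$ for every $v\in T_\Theta(\lambda(X))$.
   Context: $\mathbf{S}^n$: real symmetric matrices; $\lambda(X)$: eigenvalues in nonincreasing order; $\Theta$ symmetric: invariant under coordinate permutations. Tangent cone $T_C(\bar x)=\{w:\exists t_k\downarrow0,w_k\to w,\bar x+t_kw_k\in C\}$; second-order tangent set $T^2_C(\bar x,w)=\{u:\exists t_k\downarrow0,u_k\to u,\ \bar x+t_kw+\tfrac12t_k^2u_k\in C\}$. $C$ is parabolically derivable at $\bar x$ for $w\in T_C(\bar x)$ if $T^2_C(\bar x,w)\ne\emptyset$ and for each $u\in T^2_C(\bar x,w)$ there are $\varepsilon>0$ and $\xi:[0,\varepsilon]\to C$ with $\xi(0)=\bar x$, $\xi'_+(0)=w$, $\xi''_+(0)=u$, where $\xi'_+(0)=\lim_{t\downarrow0}(\xi(t)-\xi(0))/t$ and $\xi''_+(0)=\lim_{t\downarrow0}(\xi(t)-\xi(0)-t\xi'_+(0))/(\frac12t^2)$.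 $\lambda'(X;H)=\lim_{t\downarrow0}(\lambda(X+tH)-\lambda(X))/t$ and $\lambda''(X;H,W)=\lim_{t\downarrow0}\frac{\lambda(X+tH+\frac12t^2W)-\lambda(X)-t\lambda'(X;H)}{\frac12t^2}$ (both exist). *)

theory Defs
  imports "HOL-Analysis.Analysis" "HOL-Library.Multiset"
begin

definition sym_mats :: "(real^'n^'n) set" where
  "sym_mats = {X. transpose X = X}"

definition eig_mset :: "real^'n^'n \<Rightarrow> real multiset" where
  "eig_mset X = (THE M. size M = CARD('n) \<and>
      (\<forall>t::real. det (mat t - X) = prod_mset (image_mset (\<lambda>\<mu>. t - \<mu>) M)))"

text \<open>lambda(X): eigenvalues in nonincreasing order, as a vector in R^n; the
  coordinates of R^n are ordered by the linear order of the index type.\<close>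
definition eigvec :: "real^'n::{finite,linorder}^'n::{finite,linorder} \<Rightarrow> real^'n::{finite,linorder}" where
  "eigvec X = (\<chi> i. rev (sorted_list_of_multiset (eig_mset X)) ! card {j. j < i})"

definition perm_symmetric :: "(real^'n) set \<Rightarrow> bool" where
  "perm_symmetric \<Theta> \<longleftrightarrow>
     (\<forall>\<sigma> x. \<sigma> permutes (UNIV::'n set) \<longrightarrow> x \<in> \<Theta> \<longrightarrow> (\<chi> i. x $ \<sigma> i) \<in> \<Theta>)"

definition tangent_cone :: "'a::real_normed_vector set \<Rightarrow> 'a \<Rightarrow> 'a set" where
  "tangent_cone C x = {w. \<exists>t wk. (\<forall>k. t k > 0) \<and> t \<longlonglongrightarrow> 0 \<and> wk \<longlonglongrightarrow> w \<and>
       (\<forall>k. x + t k *\<^sub>R wk k \<in> C)}"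

definition second_tangent :: "'a::real_normed_vector set \<Rightarrow> 'a \<Rightarrow> 'a \<Rightarrow> 'a set" where
  "second_tangent C x w = {u. \<exists>t uk. (\<forall>k. t k > 0) \<and> t \<longlonglongrightarrow> 0 \<and> uk \<longlonglongrightarrow> u \<and>
       (\<forall>k. x + t k *\<^sub>R w + (t k ^ 2 / 2) *\<^sub>R uk k \<in> C)}"

definition parabolically_derivable :: "'a::real_normed_vector set \<Rightarrow> 'a \<Rightarrow> 'a \<Rightarrow> bool" where
  "parabolically_derivable C x w \<longleftrightarrow>
     w \<in> tangent_cone C x \<and> second_tangent C x w \<noteq> {} \<and>
     (\<forall>u \<in> second_tangent C x w. \<exists>\<epsilon>>0. \<exists>\<xi>::real \<Rightarrow> 'a.
        (\<forall>t\<in>{0..\<epsilon>}. \<xi> t \<in> C) \<and> \<xi> 0 = x \<and>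
        ((\<lambda>t. (1 / t) *\<^sub>R (\<xi> t - \<xi> 0)) \<longlongrightarrow> w) (at_right 0) \<and>
        ((\<lambda>t. (1 / (t ^ 2 / 2)) *\<^sub>R (\<xi> t - \<xi> 0 - t *\<^sub>R w)) \<longlongrightarrow> u) (at_right 0))"

text \<open>First and second directional derivatives of lambda (they exist for symmetric X, H, W).\<close>
definition eig_dir1 :: "real^'n::{finite,linorder}^'n::{finite,linorder} \<Rightarrow> real^'n::{finite,linorder}^'n::{finite,linorder} \<Rightarrow> real^'n::{finite,linorder}" where
  "eig_dir1 X H = Lim (at_right 0) (\<lambda>t. (1 / t) *\<^sub>R (eigvec (X + t *\<^sub>R H) - eigvec X))"

definition eig_dir2 :: "real^'n::{finite,linorder}^'n::{finite,linorder} \<Rightarrow> real^'n::{finite,linorder}^'n::{finite,linorder} \<Rightarrow> real^'n::{finite,linorder}^'n::{finite,linorder} \<Rightarrow> real^'n::{finite,linorder}" where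
  "eig_dir2 X H W = Lim (at_right 0) (\<lambda>t. (1 / (t ^ 2 / 2)) *\<^sub>R
       (eigvec (X + t *\<^sub>R H + (t ^ 2 / 2) *\<^sub>R W) - eigvec X - t *\<^sub>R eig_dir1 X H))"

end

theory Submission
  imports Defs
begin

text \<open>Write \<open>Z = U diag(d) U\<^sup>T\<close> with \<open>U\<close> orthogonal. Replacing the spectrum of a symmetric \<open>Y\<close> by a
  point of the symmetric set \<open>\<Theta>\<close>, with the eigenvectors kept, gives a point of \<open>C\<close> at a comparable
  distance, and conversely the ordered eigenvalues are Lipschitz; so remainders of order \<open>o(t\<^sup>2)\<close> pass
  between \<open>C\<close> and \<open>\<Theta>\<close>. Once the second-order expansion of the eigenvalues along
  \<open>X + t H + t\<^sup>2/2 W\<close> is known, this yields the formula for the second-order tangent set and the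
  transfer of parabolic arcs; nonemptiness follows by compactness, since \<open>O(t\<^sup>2)\<close> remainders have
  convergent rescaled subsequences.

  For the expansion, choose a skew matrix \<open>K\<close> such that \<open>H + X K - K X\<close> commutes with \<open>X\<close>. The
  congruence by \<open>1 + t K\<close> is orthogonal up to \<open>O(t\<^sup>2)\<close>, so the eigenvalues of \<open>X + t H\<close> are affine in
  \<open>t\<close> up to \<open>O(t\<^sup>2)\<close>. Hence the second-order difference quotient is bounded. It takes all but
  finitely many values only at roots of a nonzero polynomial in \<open>t\<close>, so by the intermediate value
  theorem it cannot oscillate as \<open>t\<close> tends to 0.\<close>

section \<open>Simultaneous diagonalisation\<close>

text \<open>The norm of a matrix here is the Frobenius norm, so Cauchy-Schwarz in each row
  suffices.\<close>

lemma matrix_vector_norm_le: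
  fixes A :: "real^'n^'m"
  shows "norm (A *v x) \<le> norm A * norm x"
proof -
  have "norm (A *v x) = L2_set (\<lambda>i. \<bar>A $ i \<bullet> x\<bar>) UNIV"
    by (simp add: norm_vec_def matrix_vector_mult_def inner_vec_def)
  also have "\<dots> \<le> L2_set (\<lambda>i. norm (A $ i) * norm x) UNIV"
    by (intro L2_set_mono) (auto simp: Cauchy_Schwarz_ineq2)
  also have "\<dots> = norm A * norm x"
    by (simp add: norm_vec_def[of A] L2_set_left_distrib)
  finally show ?thesis .
qed

lemma abs_quadratic_form_le:
  fixes A :: "real^'n^'n"
  shows "\<bar>y \<bullet> (A *v y)\<bar> \<le> norm A * (y \<bullet> y)"
proof -
  have "\<bar>y \<bullet> (A *v y)\<bar> \<le> norm y * norm (A *v y)"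
    by (rule Cauchy_Schwarz_ineq2)
  also have "\<dots> \<le> norm y * (norm A * norm y)"
    by (intro mult_left_mono matrix_vector_norm_le) auto
  finally show ?thesis by (simp add: dot_square_norm power2_eq_square ac_simps)
qed

lemma symmetric_form_swap:
  fixes A :: "real^'n^'n"
  assumes "transpose A = A"
  shows "x \<bullet> (A *v y) = y \<bullet> (A *v x)"
  by (metis assms dot_lmul_matrix inner_commute vector_transpose_matrix)

text \<open>The form attains its maximum on the compact unit sphere of \<open>V\<close>; homogeneity
  of degree two extends the bound to all of \<open>V\<close>.\<close>

lemma quadratic_form_max:
  fixes A :: "real^'n^'n"
  assumes "subspace V" "V \<noteq> {0}"
  obtains x where "x \<in> V" "norm x = 1" "\<And>y. y \<in> V \<Longrightarrow> y \<bullet> (A *v y) \<le> (x \<bullet> (A *v x)) * (y \<bullet> y)"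
proof -
  let ?S = "V \<inter> sphere 0 1"
  have norm_in: "(1 / norm y) *\<^sub>R y \<in> ?S" if "y \<in> V" "y \<noteq> 0" for y
    using that assms(1) by (auto simp: subspace_scale)
  obtain v where "v \<in> V" "v \<noteq> 0"
    using assms subspace_0 by blast
  then have "?S \<noteq> {}" using norm_in by blast
  moreover have "compact ?S"
    using closed_subspace[OF assms(1)] compact_sphere by (simp add: closed_Int_compact)
  moreover have "continuous_on ?S (\<lambda>x. x \<bullet> (A *v x))"
    by (intro continuous_on_inner continuous_on_id matrix_vector_mult_linear_continuous_on)
  ultimately obtain x where x: "x \<in> ?S" "\<forall>y\<in>?S. y \<bullet> (A *v y) \<le> x \<bullet> (A *v x)"
    using continuous_attains_sup[of ?S "\<lambda>x. x \<bullet> (A *v x)"] by metis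
  have "y \<bullet> (A *v y) \<le> (x \<bullet> (A *v x)) * (y \<bullet> y)" if "y \<in> V" for y
  proof (cases "y = 0")
    case False
    have "((1 / norm y) *\<^sub>R y) \<bullet> (A *v ((1 / norm y) *\<^sub>R y)) \<le> x \<bullet> (A *v x)"
      using x(2) norm_in that False by blast
    moreover have "((1 / norm y) *\<^sub>R y) \<bullet> (A *v ((1 / norm y) *\<^sub>R y)) = y \<bullet> (A *v y) / (y \<bullet> y)"
      by (simp add: matrix_vector_mult_scaleR dot_square_norm power2_eq_square)
    ultimately have "y \<bullet> (A *v y) / (y \<bullet> y) \<le> x \<bullet> (A *v x)" by metis
    then show ?thesis
      using False by (simp add: pos_divide_le_eq)
  qed simp
  with x(1) that show thesis by auto
qed

text \<open>First-order optimality: along \<open>x + t w\<close> the slack in \<open>max\<close> is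
  \<open>2 t \<alpha> + t^2 \<beta>\<close>, which can be nonnegative for all \<open>t\<close> only
  if \<open>\<alpha> = 0\<close>.\<close>

lemma quadratic_form_max_critical:
  fixes A :: "real^'n^'n"
  assumes "transpose A = A" "subspace V" "x \<in> V" "w \<in> V"
    and max: "\<And>y. y \<in> V \<Longrightarrow> y \<bullet> (A *v y) \<le> m * (y \<bullet> y)"
    and x: "x \<bullet> (A *v x) = m * (x \<bullet> x)"
  shows "w \<bullet> (A *v x) = m * (w \<bullet> x)"
proof (rule ccontr)
  define \<alpha> where "\<alpha> = m * (w \<bullet> x) - w \<bullet> (A *v x)"
  define \<beta> where "\<beta> = m * (w \<bullet> w) - w \<bullet> (A *v w)"
  assume "w \<bullet> (A *v x) \<noteq> m * (w \<bullet> x)"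
  then have "\<alpha> \<noteq> 0" by (simp add: \<alpha>_def)
  have nonneg: "0 \<le> 2 * t * \<alpha> + t\<^sup>2 * \<beta>" for t
  proof -
    have "x + t *\<^sub>R w \<in> V" using assms by (simp add: subspace_add subspace_scale)
    from max[OF this] show ?thesis
      using x symmetric_form_swap[OF assms(1), of x w]
      by (simp add: \<alpha>_def \<beta>_def matrix_vector_right_distrib matrix_vector_mult_scaleR
          inner_add_left inner_add_right algebra_simps power2_eq_square inner_commute[of x w])
  qed
  have "\<beta> \<ge> 0" using max[OF assms(4)] by (simp add: \<beta>_def)
  \<comment> \<open>At \<open>t = - \<alpha> s\<close> the slack equals
    \<open>- \<alpha>^2 s (2 - s \<beta>)\<close>; this \<open>s\<close> keeps
    \<open>s \<beta>\<close> below 2 and also covers \<open>\<beta> = 0\<close>.\<close>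
  define s where "s = 1 / (\<beta> + 1)"
  have "0 < s" "s * \<beta> < 2"
    using \<open>\<beta> \<ge> 0\<close> by (auto simp: s_def field_simps)
  then have "0 < \<alpha>\<^sup>2 * (s * (2 - s * \<beta>))"
    using \<open>\<alpha> \<noteq> 0\<close> by (intro mult_pos_pos) auto
  moreover have "2 * (- \<alpha> * s) * \<alpha> + (- \<alpha> * s)\<^sup>2 * \<beta> = - (\<alpha>\<^sup>2 * (s * (2 - s * \<beta>)))"
    by (simp add: algebra_simps power2_eq_square)
  ultimately show False using nonneg[of "- \<alpha> * s"] by linarith
qed

text \<open>Lexicographic Rayleigh principle: split off a vector that maximises the form of \<open>A\<close> and,
  among these maximisers, the form of \<open>B\<close>; then pass to its orthogonal complement.\<close>

lemma forms_diagonalizing_basis: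
  fixes A B :: "real^'n^'n"
  assumes A: "transpose A = A" and B: "transpose B = B" and "subspace V"
  shows "\<exists>S \<subseteq> V. finite S \<and> card S = dim V \<and> pairwise orthogonal S \<and> (\<forall>u\<in>S. norm u = 1) \<and>
    (\<forall>u\<in>S. \<forall>w\<in>S. u \<noteq> w \<longrightarrow> u \<bullet> (A *v w) = 0 \<and>
        (u \<bullet> (A *v u) = w \<bullet> (A *v w) \<longrightarrow> u \<bullet> (B *v w) = 0))"
  using \<open>subspace V\<close>
proof (induction "dim V" arbitrary: V)
  case 0
  then show ?case by (intro exI[of _ "{}"]) (auto simp: pairwise_def)
next
  case (Suc d)
  then have "V \<noteq> {0}" by auto
  then obtain x0 where x0: "x0 \<in> V" "norm x0 = 1"
      "\<And>y. y \<in> V \<Longrightarrow> y \<bullet> (A *v y) \<le> (x0 \<bullet> (A *v x0)) * (y \<bullet> y)"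
    using quadratic_form_max[OF Suc.prems, of A] by blast
  define m where "m = x0 \<bullet> (A *v x0)"
  \<comment> \<open>The top eigenspace of the compression of \<open>A\<close> to \<open>V\<close>.
    By \<open>critical\<close> it contains every maximiser, and the form of \<open>B\<close> is
    maximised inside it.\<close>
  define E where "E = {y \<in> V. \<forall>w\<in>V. w \<bullet> (A *v y) = m * (w \<bullet> y)}"
  have critical: "y \<in> E" if "y \<in> V" "y \<bullet> (A *v y) = m * (y \<bullet> y)" for y
    unfolding E_def using that x0(3)
    by (auto simp: m_def intro: quadratic_form_max_critical[OF A Suc.prems])
  have "subspace E"
    using Suc.prems unfolding E_def subspace_def
    by (auto simp: matrix_vector_right_distrib matrix_vector_mult_scaleR inner_add_right algebra_simps)
  moreover have "E \<noteq> {0}"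
    using critical[of x0] x0 by (force simp: m_def norm_eq_1)
  ultimately obtain x where x: "x \<in> E" "norm x = 1"
      "\<And>y. y \<in> E \<Longrightarrow> y \<bullet> (B *v y) \<le> (x \<bullet> (B *v x)) * (y \<bullet> y)"
    using quadratic_form_max[of E B] by blast
  have xV: "x \<in> V" and xA: "\<And>w. w \<in> V \<Longrightarrow> w \<bullet> (A *v x) = m * (w \<bullet> x)"
    using x(1) by (auto simp: E_def)
  have xB: "w \<bullet> (B *v x) = (x \<bullet> (B *v x)) * (w \<bullet> x)" if "w \<in> E" for w
    using quadratic_form_max_critical[OF B \<open>subspace E\<close> x(1) that x(3)] x(2) by (simp add: norm_eq_1)
  \<comment> \<open>Phrased with \<open>span {x}\<close> to match the dimension formula for
    orthogonal complements; \<open>V'_alt\<close> is the working form.\<close>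
  define V' where "V' = {y \<in> V. \<forall>z\<in>span {x}. orthogonal z y}"
  have V'_alt: "V' = {y \<in> V. x \<bullet> y = 0}"
    by (auto simp: V'_def orthogonal_def span_singleton)
  have "dim V' + dim (span {x}) = dim V"
    unfolding V'_def using xV Suc.prems by (intro dim_subspace_orthogonal_to_vectors) (auto simp: span_minimal)
  moreover have "dim (span {x}) = 1"
    using x(2) by (auto simp: dim_singleton)
  ultimately have "d = dim V'" using Suc.hyps(2) by simp
  moreover have "subspace V'"
    using Suc.prems unfolding V'_alt subspace_def by (auto simp: inner_add_right)
  ultimately obtain S where S: "S \<subseteq> V'" "finite S" "card S = d" "pairwise orthogonal S" "\<forall>u\<in>S. norm u = 1"
      "\<forall>u\<in>S. \<forall>w\<in>S. u \<noteq> w \<longrightarrow> u \<bullet> (A *v w) = 0 \<and> (u \<bullet> (A *v u) = w \<bullet> (A *v w) \<longrightarrow> u \<bullet> (B *v w) = 0)"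
    using Suc.hyps(1)[of V'] by metis
  have Sx: "u \<in> V" "x \<bullet> u = 0" "u \<bullet> x = 0" if "u \<in> S" for u
    using S(1) that by (auto simp: V'_alt inner_commute)
  have "x \<notin> S" using Sx(2)[of x] x(2) by (auto simp: norm_eq_1)
  \<comment> \<open>A unit vector with the same value of \<open>A\<close> as \<open>x\<close> also
    attains the maximum \<open>m\<close>, so it lies in \<open>E\<close>, where \<open>x\<close> is
    critical for \<open>B\<close>.\<close>
  have ux: "u \<bullet> (A *v x) = 0" "u \<bullet> (A *v u) = x \<bullet> (A *v x) \<Longrightarrow> u \<bullet> (B *v x) = 0" if "u \<in> S" for u
  proof -
    show "u \<bullet> (A *v x) = 0" using xA Sx that by simp
    assume "u \<bullet> (A *v u) = x \<bullet> (A *v x)"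
    then have "u \<bullet> (A *v u) = m * (u \<bullet> u)"
      using xA[OF xV] x(2) S(5) that by (simp add: norm_eq_1)
    then have "u \<in> E" using critical Sx that by blast
    then show "u \<bullet> (B *v x) = 0" using xB Sx that by simp
  qed
  have xu: "x \<bullet> (A *v u) = 0" "x \<bullet> (A *v x) = u \<bullet> (A *v u) \<Longrightarrow> x \<bullet> (B *v u) = 0" if "u \<in> S" for u
    using ux[OF that] symmetric_form_swap[OF A, of x u] symmetric_form_swap[OF B, of x u] by auto
  show ?case
  proof (intro exI[of _ "insert x S"] conjI)
    show "insert x S \<subseteq> V" using Sx xV by auto
    show "card (insert x S) = dim V" using S \<open>x \<notin> S\<close> Suc.hyps(2) by simp
    show "pairwise orthogonal (insert x S)"
      using S(4) Sx by (auto simp: pairwise_insert orthogonal_def)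
  qed (use S x(2) ux xu in auto)
qed

text \<open>\<open>A\<close> and \<open>B\<close> need not commute, so \<open>B\<close> is made
  diagonal only within each eigenvalue block of \<open>A\<close>. The orthonormal family of
  \<open>forms_diagonalizing_basis\<close> supplies the columns of \<open>U\<close>.\<close>

lemma orthogonal_diagonalization_pair:
  fixes A B :: "real^'n^'n"
  assumes A: "transpose A = A" and B: "transpose B = B"
  obtains U where "orthogonal_matrix U"
    "\<And>i j. i \<noteq> j \<Longrightarrow> (transpose U ** A ** U) $ i $ j = 0"
    "\<And>i j. i \<noteq> j \<Longrightarrow> (transpose U ** A ** U) $ i $ i = (transpose U ** A ** U) $ j $ j
       \<Longrightarrow> (transpose U ** B ** U) $ i $ j = 0"
proof -
  obtain S :: "(real^'n) set" where S: "finite S" "card S = CARD('n)" "pairwise orthogonal S" "\<forall>u\<in>S. norm u = 1"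
    "\<forall>u\<in>S. \<forall>w\<in>S. u \<noteq> w \<longrightarrow> u \<bullet> (A *v w) = 0 \<and> (u \<bullet> (A *v u) = w \<bullet> (A *v w) \<longrightarrow> u \<bullet> (B *v w) = 0)"
    using forms_diagonalizing_basis[OF A B subspace_UNIV] by (auto simp: dim_UNIV)
  obtain f where f: "bij_betw f (UNIV::'n set) S"
    using S by (metis finite_class.finite_UNIV finite_same_card_bij)
  define U :: "real^'n^'n" where "U = (\<chi> i j. f j $ i)"
  have fS: "f i \<in> S" for i using f by (auto simp: bij_betw_def)
  have fneq: "f i \<noteq> f j" if "i \<noteq> j" for i j using f that by (auto simp: bij_betw_def inj_on_def)
  have col: "column i U = f i" for i
    by (simp add: U_def column_def vec_eq_iff)
  have entry: "(transpose U ** M ** U) $ i $ j = f i \<bullet> (M *v f j)" for M :: "real^'n^'n" and i j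
    unfolding matrix_mul_assoc[symmetric]
    by (simp add: matrix_matrix_mult_def transpose_def U_def inner_vec_def matrix_vector_mult_def)
  have "orthogonal_matrix U"
    using S(3,4) fS fneq by (simp add: orthogonal_matrix_orthonormal_columns col pairwise_def)
  moreover have "(transpose U ** A ** U) $ i $ j = 0" if "i \<noteq> j" for i j
    unfolding entry using S(5)[rule_format, OF fS fS fneq[OF that]] by simp
  moreover have "(transpose U ** B ** U) $ i $ j = 0"
    if "i \<noteq> j" "(transpose U ** A ** U) $ i $ i = (transpose U ** A ** U) $ j $ j" for i j
    using that(2) S(5)[rule_format, OF fS fS fneq[OF that(1)]] unfolding entry by simp
  ultimately show thesis by (rule that)
qed

section \<open>Spectral decompositions and the ordered eigenvalue vector\<close>

text \<open>The product U diag(d) U^T, written entrywise so that linearity in \<open>d\<close> is a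
  fact about sums; \<open>spec_eq_conj\<close> restores the product.\<close>

definition spec :: "real^'n^'n \<Rightarrow> real^'n \<Rightarrow> real^'n^'n" where
  "spec U d = (\<chi> i j. \<Sum>k\<in>UNIV. U $ i $ k * d $ k * U $ j $ k)"

definition antitone_vec :: "real^'n::{finite,linorder} \<Rightarrow> bool" where
  "antitone_vec d \<longleftrightarrow> (\<forall>i j. i \<le> j \<longrightarrow> d $ j \<le> d $ i)"

lemma spec_diff: "spec U (a - b) = spec U a - spec U b"
  by (simp add: spec_def vec_eq_iff algebra_simps sum_subtractf)

lemma spec_add: "spec U (a + b) = spec U a + spec U b"
  by (simp add: spec_def vec_eq_iff algebra_simps sum.distrib)

lemma spec_scaleR: "spec U (c *\<^sub>R a) = c *\<^sub>R spec U a"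
  by (simp add: spec_def vec_eq_iff sum_distrib_left mult_ac)

lemma spec_minus: "spec U (- a) = - spec U a"
  by (simp add: spec_def vec_eq_iff sum_negf)

lemma spec_symmetric: "transpose (spec U d) = spec U d"
  by (simp add: spec_def transpose_def vec_eq_iff mult_ac)

lemma spec_in_sym_mats: "spec U d \<in> sym_mats"
  by (simp add: sym_mats_def spec_symmetric)

lemma spec_eq_conj: "spec U d = U ** (\<chi> i j. if i = j then d $ i else 0) ** transpose U"
  by (simp add: spec_def matrix_matrix_mult_def transpose_def vec_eq_iff if_distrib sum.delta cong: if_cong)

lemma spec_const:
  assumes "orthogonal_matrix U"
  shows "spec U (\<chi> i. t) = mat t"
proof -
  have "(U ** transpose U) $ i $ j = mat 1 $ i $ j" for i j
    using assms by (simp add: orthogonal_matrix_def)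
  then have "(\<Sum>k\<in>UNIV. U $ i $ k * U $ j $ k) = (if i = j then 1 else 0)" for i j
    by (simp add: matrix_matrix_mult_def transpose_def mat_def)
  then have "(\<Sum>k\<in>UNIV. U $ i $ k * t * U $ j $ k) = (if i = j then t else 0)" for i j
    by (simp add: mult.commute[of _ t] mult.assoc sum_distrib_left[symmetric])
  then show ?thesis by (simp add: spec_def mat_def vec_eq_iff)
qed

lemma spec_of_diagonal_conj:
  fixes A U :: "real^'n^'n"
  assumes U: "orthogonal_matrix U" and diag: "\<And>i j. i \<noteq> j \<Longrightarrow> (transpose U ** A ** U) $ i $ j = 0"
  shows "A = spec U (\<chi> i. (transpose U ** A ** U) $ i $ i)"
proof -
  have "(\<chi> i j. if i = j then (\<chi> i. (transpose U ** A ** U) $ i $ i) $ i else 0) = transpose U ** A ** U"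
    using diag by (auto simp: vec_eq_iff)
  then have "spec U (\<chi> i. (transpose U ** A ** U) $ i $ i) = (U ** transpose U) ** A ** (U ** transpose U)"
    by (simp only: spec_eq_conj matrix_mul_assoc)
  then show ?thesis using U by (simp add: orthogonal_matrix_def)
qed

lemma det_spec:
  assumes "orthogonal_matrix U"
  shows "det (spec U d) = (\<Prod>i\<in>UNIV. d $ i)"
proof -
  have "det U * det (transpose U) = 1"
    using assms by (metis det_I det_mul orthogonal_matrix_def)
  then show ?thesis
    by (simp add: spec_eq_conj det_mul det_diagonal mult.commute mult.left_commute)
qed

lemma det_mat_minus_spec:
  assumes "orthogonal_matrix U"
  shows "det (mat t - spec U d) = (\<Prod>i\<in>UNIV. t - d $ i)"
  using det_spec[OF assms, of "(\<chi> i. t) - d"] by (simp add: spec_diff spec_const[OF assms])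

text \<open>Two monic split polynomials that agree as functions are equal, and \<open>proots\<close>
  reads the multiset back. This gives the uniqueness needed to evaluate the \<open>THE\<close> in
  \<open>eig_mset\<close>.\<close>

lemma mset_eq_of_prod_linear_factors:
  fixes M N :: "real multiset"
  assumes "\<And>t. (\<Prod>\<mu>\<in>#M. t - \<mu>) = (\<Prod>\<mu>\<in>#N. t - \<mu>)"
  shows "M = N"
proof -
  have poly_eq: "poly (\<Prod>\<mu>\<in>#K. [:- \<mu>, 1:]) t = (\<Prod>\<mu>\<in>#K. t - \<mu>)" for K :: "real multiset" and t
    by (simp add: poly_prod_mset)
  have roots: "proots (\<Prod>\<mu>\<in>#K. [:- \<mu>, 1:]) = K" for K :: "real multiset"
  proof (induction K)
    case (add x K)
    have "(\<Prod>\<mu>\<in>#K. [:- \<mu>, 1:]) \<noteq> 0" by (auto simp: prod_mset_zero_iff)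
    then show ?case using add by (simp add: proots_mult del: mult_pCons_left)
  qed simp
  have "(\<Prod>\<mu>\<in>#M. [:- \<mu>, 1:]) = (\<Prod>\<mu>\<in>#N. [:- \<mu>, 1:])"
    using assms by (intro poly_eq_poly_eq_iff[THEN iffD1] ext) (simp add: poly_eq)
  then show ?thesis by (metis roots)
qed

lemma eig_mset_spec:
  fixes U :: "real^'n^'n"
  assumes "orthogonal_matrix U"
  shows "eig_mset (spec U d) = image_mset (($) d) (mset_set UNIV)"
  unfolding eig_mset_def
proof (rule the_equality, intro conjI allI)
  fix t
  show "det (mat t - spec U d) = (\<Prod>\<mu>\<in>#image_mset (($) d) (mset_set UNIV). t - \<mu>)"
    by (simp add: det_mat_minus_spec[OF assms] prod_unfold_prod_mset image_mset.compositionality o_def)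
next
  fix M assume "size M = CARD('n) \<and> (\<forall>t. det (mat t - spec U d) = (\<Prod>\<mu>\<in>#M. t - \<mu>))"
  then show "M = image_mset (($) d) (mset_set UNIV)"
    by (intro mset_eq_of_prod_linear_factors)
      (metis (no_types, lifting) assms det_mat_minus_spec prod_unfold_prod_mset image_mset.compositionality image_mset_cong o_def)
qed simp

section \<open>From the multiset of eigenvalues to the ordered vector\<close>

lemma card_less_bij:
  "bij_betw (\<lambda>i::'n::{finite,linorder}. card {j. j < i}) UNIV {..<CARD('n)}"
proof -
  have mono: "card {j. j < i} < card {j. j < k}" if "i < k" for i k :: 'n
    using that by (intro psubset_card_mono) auto
  have "inj (\<lambda>i::'n. card {j. j < i})"
    by (rule injI) (metis mono less_irrefl neq_iff)
  moreover have "card {j. j < i} < CARD('n)" for i :: 'n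
    by (intro psubset_card_mono) auto
  ultimately show ?thesis
    by (intro bij_betw_imageI card_subset_eq) (auto simp: card_image)
qed

lemma eigvec_antitone:
  fixes X :: "real^'n::{finite,linorder}^'n::{finite,linorder}"
  assumes "size (eig_mset X) = CARD('n)"
  shows "antitone_vec (eigvec X)"
  unfolding antitone_vec_def
proof (intro allI impI)
  fix i j :: 'n assume "i \<le> j"
  let ?L = "rev (sorted_list_of_multiset (eig_mset X))"
  have "card {k. k < i} \<le> card {k. k < j}"
    using \<open>i \<le> j\<close> by (intro card_mono) auto
  moreover have "card {k. k < j} < length ?L"
    using assms bij_betwE[OF card_less_bij[where 'n='n]] by (simp flip: size_mset)
  moreover have "sorted_wrt (\<ge>) ?L"
    by (simp add: sorted_wrt_rev)
  ultimately show "eigvec X $ j \<le> eigvec X $ i"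
    unfolding eigvec_def
    by (cases "card {k. k < i} = card {k. k < j}") (auto simp: sorted_wrt_iff_nth_less)
qed

lemma mset_eigvec:
  fixes X :: "real^'n::{finite,linorder}^'n::{finite,linorder}"
  assumes "size (eig_mset X) = CARD('n)"
  shows "image_mset (($) (eigvec X)) (mset_set UNIV) = eig_mset X"
proof -
  let ?L = "rev (sorted_list_of_multiset (eig_mset X))" and ?r = "\<lambda>i::'n. card {j. j < i}"
  have len: "length ?L = CARD('n)" using assms by (simp flip: size_mset)
  have "image_mset (($) (eigvec X)) (mset_set UNIV) = image_mset ((!) ?L) (image_mset ?r (mset_set UNIV))"
    unfolding image_mset.compositionality by (intro image_mset_cong) (simp add: eigvec_def)
  also have "image_mset ?r (mset_set UNIV) = mset_set {..<CARD('n)}"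
    using card_less_bij[where 'n='n] by (simp add: image_mset_mset_set bij_betw_def)
  also have "image_mset ((!) ?L) (mset_set {..<CARD('n)}) = mset ?L"
    by (metis len map_nth mset_map mset_upt atLeast0LessThan)
  finally show ?thesis by simp
qed

lemma size_eig_mset_spec:
  fixes U :: "real^'n^'n"
  shows "orthogonal_matrix U \<Longrightarrow> size (eig_mset (spec U d)) = CARD('n)"
  by (simp add: eig_mset_spec)

text \<open>Both vectors have the same multiset of entries, and equal multisets over a finite index
  type differ by a permutation.\<close>

lemma eigvec_spec_permutes:
  fixes U :: "real^'n::{finite,linorder}^'n::{finite,linorder}"
  assumes "orthogonal_matrix U"
  obtains \<sigma> where "\<sigma> permutes UNIV" "eigvec (spec U d) = (\<chi> i. d $ \<sigma> i)"
proof -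
  have "image_mset (($) (eigvec (spec U d))) (mset_set UNIV) = image_mset (($) d) (mset_set UNIV)"
    using assms by (simp add: mset_eigvec size_eig_mset_spec eig_mset_spec)
  then obtain \<sigma> where "\<sigma> permutes UNIV" "\<forall>i\<in>UNIV. eigvec (spec U d) $ i = d $ \<sigma> i"
    by (rule image_mset_eq_implies_permutes[OF finite])
  then show thesis by (intro that) (auto simp: vec_eq_iff)
qed

lemma antitone_eigvec_spec:
  "orthogonal_matrix U \<Longrightarrow> antitone_vec (eigvec (spec U d))"
  by (intro eigvec_antitone size_eig_mset_spec)

lemma spec_permute:
  fixes U :: "real^'n^'n"
  assumes "\<sigma> permutes UNIV"
  shows "spec (\<chi> i j. U $ i $ \<sigma> j) (\<chi> i. d $ \<sigma> i) = spec U d"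
proof -
  have "(\<Sum>k\<in>UNIV. U $ i $ \<sigma> k * d $ \<sigma> k * U $ j $ \<sigma> k) = (\<Sum>k\<in>UNIV. U $ i $ k * d $ k * U $ j $ k)" for i j
    using sum.permute[OF assms, of "\<lambda>k. U $ i $ k * d $ k * U $ j $ k"] by (simp add: o_def)
  then show ?thesis by (simp add: spec_def)
qed

lemma orthogonal_matrix_permute:
  fixes U :: "real^'n^'n"
  assumes "orthogonal_matrix U" "\<sigma> permutes UNIV"
  shows "orthogonal_matrix (\<chi> i j. U $ i $ \<sigma> j)"
proof -
  have "column j (\<chi> i j. U $ i $ \<sigma> j) = column (\<sigma> j) U" for j
    by (simp add: column_def)
  moreover have "\<sigma> i \<noteq> \<sigma> j" if "i \<noteq> j" for i j
    using assms(2) that by (metis permutes_inj injD)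
  ultimately show ?thesis
    using assms(1) by (auto simp: orthogonal_matrix_orthonormal_columns)
qed

text \<open>Diagonalise the pair \<open>X\<close>, \<open>X\<close>, then permute the columns so
  that the eigenvalues appear in the order of \<open>eigvec X\<close>.\<close>

lemma spectral_theorem:
  fixes X :: "real^'n::{finite,linorder}^'n::{finite,linorder}"
  assumes "X \<in> sym_mats"
  obtains U where "orthogonal_matrix U" "X = spec U (eigvec X)"
proof -
  have "transpose X = X" using assms by (simp add: sym_mats_def)
  then obtain V where V: "orthogonal_matrix V" "\<And>i j. i \<noteq> j \<Longrightarrow> (transpose V ** X ** V) $ i $ j = 0"
    using orthogonal_diagonalization_pair[of X X] by metis
  then obtain d where X: "X = spec V d"
    using spec_of_diagonal_conj by blast
  obtain \<sigma> where \<sigma>: "\<sigma> permutes UNIV" "eigvec X = (\<chi> i. d $ \<sigma> i)"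
    using eigvec_spec_permutes[OF V(1)] X by metis
  show thesis
    using that[OF orthogonal_matrix_permute[OF V(1) \<sigma>(1)]] spec_permute[OF \<sigma>(1)] \<sigma>(2) X by metis
qed

section \<open>Perturbation of the ordered eigenvalues\<close>

text \<open>Parseval's identity for the orthonormal columns of \<open>U\<close>.\<close>

lemma sum_square_columns:
  fixes U :: "real^'n^'n"
  assumes "orthogonal_matrix U"
  shows "(\<Sum>k\<in>UNIV. (y \<bullet> column k U)\<^sup>2) = y \<bullet> y"
proof -
  have "(\<Sum>k\<in>UNIV. (y \<bullet> column k U)\<^sup>2) = (transpose U *v y) \<bullet> (transpose U *v y)"
    by (simp add: inner_vec_def matrix_vector_mult_def transpose_def column_def power2_eq_square mult.commute)
  also have "\<dots> = y \<bullet> ((U ** transpose U) *v y)"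
    by (metis dot_lmul_matrix matrix_vector_mul_assoc vector_transpose_matrix transpose_transpose)
  finally show ?thesis using assms by (simp add: orthogonal_matrix_def)
qed

lemma spec_quadratic_form:
  fixes U :: "real^'n^'n"
  shows "y \<bullet> (spec U d *v y) = (\<Sum>k\<in>UNIV. d $ k * (y \<bullet> column k U)\<^sup>2)"
proof -
  have "y \<bullet> (spec U d *v y) = (\<Sum>i\<in>UNIV. \<Sum>j\<in>UNIV. \<Sum>k\<in>UNIV. d $ k * (y $ i * U $ i $ k) * (y $ j * U $ j $ k))"
    by (simp add: inner_vec_def matrix_vector_mult_def spec_def sum_distrib_left sum_distrib_right mult_ac)
  also have "\<dots> = (\<Sum>k\<in>UNIV. \<Sum>i\<in>UNIV. \<Sum>j\<in>UNIV. d $ k * (y $ i * U $ i $ k) * (y $ j * U $ j $ k))"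
    by (rule trans[OF sum.cong[OF refl sum.swap] sum.swap])
  also have "\<dots> = (\<Sum>k\<in>UNIV. d $ k * (y \<bullet> column k U)\<^sup>2)"
    unfolding power2_eq_square inner_vec_def sum_product
    by (simp add: column_def sum_distrib_left mult.assoc)
  finally show ?thesis .
qed

text \<open>In the eigenbasis the form is a weighted sum of squared coordinates, so only eigenvalues
  whose coordinate of \<open>y\<close> is nonzero need a bound.\<close>

lemma spec_quadratic_form_ge:
  fixes U :: "real^'n^'n"
  assumes "orthogonal_matrix U" "\<And>k. y \<bullet> column k U \<noteq> 0 \<Longrightarrow> c \<le> d $ k"
  shows "c * (y \<bullet> y) \<le> y \<bullet> (spec U d *v y)"
  unfolding spec_quadratic_form sum_square_columns[OF assms(1), symmetric] sum_distrib_left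
  using assms(2) by (intro sum_mono) (metis mult_right_mono mult_zero_right order_refl power_zero_numeral zero_le_power2)

lemma matrix_vector_mult_minus_left:
  fixes A :: "real^'n^'m"
  shows "(- A) *v x = - (A *v x)"
  by (simp add: matrix_vector_mult_def vec_eq_iff sum_negf)

lemma spec_quadratic_form_le:
  fixes U :: "real^'n^'n"
  assumes "orthogonal_matrix U" "\<And>k. y \<bullet> column k U \<noteq> 0 \<Longrightarrow> d $ k \<le> c"
  shows "y \<bullet> (spec U d *v y) \<le> c * (y \<bullet> y)"
  using spec_quadratic_form_ge[OF assms(1), of y "- c" "- d"] assms(2)
  by (simp add: spec_minus matrix_vector_mult_minus_left)

text \<open>The Courant--Fischer dimension count: \<open>card L + (CARD('n) - card J) < CARD('n)\<close> linear
  conditions on \<open>y\<close> have a nonzero solution.\<close>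

lemma common_test_vector:
  fixes P Q S :: "real^'n^'n" and J L :: "'n set"
  assumes "orthogonal_matrix P" "orthogonal_matrix Q" "card L < card J"
    and "\<And>j. j \<notin> L \<Longrightarrow> a $ j \<le> \<alpha>" "\<And>j. j \<in> J \<Longrightarrow> \<beta> \<le> b $ j"
  obtains y where "y \<noteq> 0" "\<beta> * (y \<bullet> y) \<le> y \<bullet> (spec Q b *v y)"
    "(S *v y) \<bullet> (spec P a *v (S *v y)) \<le> \<alpha> * ((S *v y) \<bullet> (S *v y))"
proof -
  \<comment> \<open>The conditions on \<open>S y\<close> are moved onto \<open>y\<close> through the
    transpose of \<open>S\<close>, so that all conditions are orthogonality relations for
    \<open>y\<close> itself.\<close>
  let ?F = "(\<lambda>j. transpose S *v column j P) ` L \<union> (\<lambda>j. column j Q) ` (- J)"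
  have "dim ?F \<le> card ?F" by (intro dim_le_card') auto
  also have "\<dots> \<le> card L + card (- J)"
    by (intro order_trans[OF card_Un_le] add_mono card_image_le) auto
  also have "\<dots> < CARD('n)"
    using assms(3) card_mono[OF finite subset_UNIV[of J]] by (simp add: Compl_eq_Diff_UNIV card_Diff_subset)
  finally have "dim ?F < DIM(real^'n)" by simp
  then obtain y where y: "y \<noteq> 0" "\<And>x. x \<in> ?F \<Longrightarrow> orthogonal y x"
    using orthogonal_to_subspace_exists[of ?F] span_base by metis
  have "y \<bullet> column j Q = 0" if "j \<notin> J" for j
    using y(2) that by (auto simp: orthogonal_def)
  then have "\<beta> * (y \<bullet> y) \<le> y \<bullet> (spec Q b *v y)"
    using assms(2,5) by (intro spec_quadratic_form_ge) auto
  moreover have "(S *v y) \<bullet> column j P = 0" if "j \<in> L" for j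
  proof -
    have "y \<bullet> (transpose S *v column j P) = 0"
      using y(2) that by (auto simp: orthogonal_def)
    then show ?thesis
      by (metis dot_lmul_matrix inner_commute vector_transpose_matrix transpose_transpose)
  qed
  then have "(S *v y) \<bullet> (spec P a *v (S *v y)) \<le> \<alpha> * ((S *v y) \<bullet> (S *v y))"
    using assms(1,4) by (intro spec_quadratic_form_le) auto
  ultimately show thesis using that y(1) by blast
qed

text \<open>At the common test vector the two forms are squeezed between \<open>\<beta>\<close> and
  \<open>\<alpha>\<close>. The factor \<open>S\<close> is only nearly isometric, and replacing the
  squared length of \<open>S y\<close> by that of \<open>y\<close> costs
  \<open>\<delta> * \<bar>\<alpha>\<bar>\<close>.\<close>

lemma spec_perturbation_one_sided:
  fixes P Q S :: "real^'n^'n" and J L :: "'n set"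
  assumes "orthogonal_matrix P" "orthogonal_matrix Q" "card L < card J"
    and "\<And>j. j \<notin> L \<Longrightarrow> a $ j \<le> \<alpha>" "\<And>j. j \<in> J \<Longrightarrow> \<beta> \<le> b $ j"
    and form: "\<And>y. y \<bullet> (spec Q b *v y) \<le> (S *v y) \<bullet> (spec P a *v (S *v y)) + \<epsilon> * (y \<bullet> y)"
    and isom: "\<And>y. \<bar>(S *v y) \<bullet> (S *v y) - y \<bullet> y\<bar> \<le> \<delta> * (y \<bullet> y)"
  shows "\<beta> \<le> \<alpha> + (\<epsilon> + \<delta> * \<bar>\<alpha>\<bar>)"
proof -
  obtain y where y: "y \<noteq> 0" "\<beta> * (y \<bullet> y) \<le> y \<bullet> (spec Q b *v y)"
    "(S *v y) \<bullet> (spec P a *v (S *v y)) \<le> \<alpha> * ((S *v y) \<bullet> (S *v y))"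
    using common_test_vector[OF assms(1-5)] by blast
  have "\<alpha> * ((S *v y) \<bullet> (S *v y) - y \<bullet> y) \<le> \<bar>\<alpha>\<bar> * \<bar>(S *v y) \<bullet> (S *v y) - y \<bullet> y\<bar>"
    by (metis abs_ge_self abs_mult)
  also have "\<dots> \<le> \<bar>\<alpha>\<bar> * (\<delta> * (y \<bullet> y))"
    using isom by (intro mult_left_mono) auto
  finally have "\<beta> * (y \<bullet> y) \<le> (\<alpha> + (\<epsilon> + \<delta> * \<bar>\<alpha>\<bar>)) * (y \<bullet> y)"
    using y(2,3) form[of y] by (simp add: algebra_simps)
  then show ?thesis using y(1) by (simp add: mult_le_cancel_right)
qed

text \<open>Courant-Fischer comparison at position \<open>i\<close>: the index sets up to
  \<open>i\<close> and strictly before \<open>i\<close> differ in size by one, which leaves room for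
  a test vector.\<close>

lemma spec_perturbation:
  fixes P Q S :: "real^'n::{finite,linorder}^'n::{finite,linorder}"
  assumes P: "orthogonal_matrix P" and Q: "orthogonal_matrix Q"
    and a: "antitone_vec a" and b: "antitone_vec b"
    and form: "\<And>y. \<bar>y \<bullet> (spec Q b *v y) - (S *v y) \<bullet> (spec P a *v (S *v y))\<bar> \<le> \<epsilon> * (y \<bullet> y)"
    and isom: "\<And>y. \<bar>(S *v y) \<bullet> (S *v y) - y \<bullet> y\<bar> \<le> \<delta> * (y \<bullet> y)"
  shows "\<bar>a $ i - b $ i\<bar> \<le> (\<epsilon> + \<delta> * \<bar>a $ i\<bar>)"
proof -
  have "card {j. j < i} < card {j. j \<le> i}" "card {j. i < j} < card {j. i \<le> j}"
    by (intro psubset_card_mono; force)+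
  have "b $ i \<le> a $ i + (\<epsilon> + \<delta> * \<bar>a $ i\<bar>)"
  proof (rule spec_perturbation_one_sided[OF P Q \<open>card {j. j < i} < card {j. j \<le> i}\<close> _ _ _ isom])
    show "y \<bullet> (spec Q b *v y) \<le> (S *v y) \<bullet> (spec P a *v (S *v y)) + \<epsilon> * (y \<bullet> y)" for y
      using form[of y] by linarith
  qed (use a b in \<open>auto simp: antitone_vec_def\<close>)
  \<comment> \<open>The opposite inequality comes from negating both spectra, which reverses the
    order, so the index sets from \<open>i\<close> upwards are used.\<close>
  moreover have "(- b) $ i \<le> (- a) $ i + (\<epsilon> + \<delta> * \<bar>(- a) $ i\<bar>)"
  proof (rule spec_perturbation_one_sided[OF P Q \<open>card {j. i < j} < card {j. i \<le> j}\<close> _ _ _ isom])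
    show "y \<bullet> (spec Q (- b) *v y) \<le> (S *v y) \<bullet> (spec P (- a) *v (S *v y)) + \<epsilon> * (y \<bullet> y)" for y
      using form[of y] by (simp add: spec_minus matrix_vector_mult_minus_left)
  qed (use a b in \<open>auto simp: antitone_vec_def\<close>)
  ultimately show ?thesis by simp
qed

text \<open>Two ordered spectra of the same matrix agree: the perturbation bound with
  \<open>S = mat 1\<close> and both errors zero.\<close>

lemma eigvec_spec_antitone:
  fixes U :: "real^'n::{finite,linorder}^'n::{finite,linorder}"
  assumes U: "orthogonal_matrix U" and "antitone_vec d"
  shows "eigvec (spec U d) = d"
proof -
  obtain P where P: "orthogonal_matrix P" "spec U d = spec P (eigvec (spec U d))"
    using spectral_theorem[OF spec_in_sym_mats] by blast
  have "\<bar>eigvec (spec U d) $ i - d $ i\<bar> \<le> (0 + 0 * \<bar>eigvec (spec U d) $ i\<bar>)" for i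
    by (rule spec_perturbation[OF P(1) U antitone_eigvec_spec[OF U] assms(2), where S = "mat 1"])
      (simp_all flip: P(2))
  then show ?thesis by (simp add: vec_eq_iff)
qed

lemma sym_mats_antitone:
  fixes X :: "real^'n::{finite,linorder}^'n::{finite,linorder}"
  assumes "X \<in> sym_mats"
  shows "antitone_vec (eigvec X)"
  using spectral_theorem[OF assms] antitone_eigvec_spec by metis

lemma norm_column_orthogonal:
  "orthogonal_matrix (U :: real^'n^'n) \<Longrightarrow> norm (column i U) = 1"
  by (simp add: orthogonal_matrix_orthonormal_columns)

text \<open>An eigenvalue is the value of the quadratic form at a unit eigenvector.\<close>

lemma abs_eigvec_le:
  fixes X :: "real^'n::{finite,linorder}^'n::{finite,linorder}"
  assumes "X \<in> sym_mats"
  shows "\<bar>eigvec X $ i\<bar> \<le> norm X"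
proof -
  obtain U where U: "orthogonal_matrix U" "X = spec U (eigvec X)"
    using spectral_theorem[OF assms] .
  have col: "column i U \<bullet> column k U = (if k = i then 1 else 0)" for k
    using U(1) by (auto simp: orthogonal_matrix_orthonormal_columns orthogonal_def norm_eq_1)
  have "column i U \<bullet> (spec U (eigvec X) *v column i U) = eigvec X $ i"
    unfolding spec_quadratic_form by (simp add: col if_distrib[of "\<lambda>x. x\<^sup>2"] if_distrib[of "(*) _"] cong: if_cong)
  then show ?thesis
    using abs_quadratic_form_le[of "column i U" X] norm_column_orthogonal[OF U(1), of i] U(2)
    by (simp add: norm_eq_1)
qed

text \<open>\<open>B\<close> is compared with the congruence S^T A S. With \<open>S = mat 1\<close>
  this yields Lipschitz continuity; with \<open>S = mat 1 + t *\<^sub>R K\<close> it yields the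
  first-order expansion.\<close>

lemma eigvec_perturbation:
  fixes A B S :: "real^'n::{finite,linorder}^'n::{finite,linorder}"
  assumes "A \<in> sym_mats" "B \<in> sym_mats" "\<delta> \<ge> 0"
    and "\<And>y. \<bar>y \<bullet> (B *v y) - (S *v y) \<bullet> (A *v (S *v y))\<bar> \<le> \<epsilon> * (y \<bullet> y)"
    and "\<And>y. \<bar>(S *v y) \<bullet> (S *v y) - y \<bullet> y\<bar> \<le> \<delta> * (y \<bullet> y)"
  shows "\<bar>eigvec A $ i - eigvec B $ i\<bar> \<le> (\<epsilon> + \<delta> * norm A)"
proof -
  obtain P where P: "orthogonal_matrix P" "A = spec P (eigvec A)"
    using spectral_theorem[OF assms(1)] .
  obtain Q where Q: "orthogonal_matrix Q" "B = spec Q (eigvec B)"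
    using spectral_theorem[OF assms(2)] .
  have "\<bar>eigvec A $ i - eigvec B $ i\<bar> \<le> (\<epsilon> + \<delta> * \<bar>eigvec A $ i\<bar>)"
    by (rule spec_perturbation[OF P(1) Q(1) sym_mats_antitone[OF assms(1)] sym_mats_antitone[OF assms(2)], where S = S])
      (use assms(4,5) P(2) Q(2) in simp_all)
  also have "\<dots> \<le> (\<epsilon> + \<delta> * norm A)"
    using abs_eigvec_le[OF assms(1)] assms(3) by (intro add_left_mono mult_left_mono) auto
  finally show ?thesis .
qed

text \<open>Weyl's inequality, with the Frobenius norm bounding the form of
  \<open>A - B\<close>.\<close>

lemma eigvec_lipschitz_component:
  fixes A B :: "real^'n::{finite,linorder}^'n::{finite,linorder}"
  assumes A: "A \<in> sym_mats" and B: "B \<in> sym_mats"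
  shows "\<bar>eigvec A $ i - eigvec B $ i\<bar> \<le> norm (A - B)"
proof -
  have "\<bar>eigvec A $ i - eigvec B $ i\<bar> \<le> (norm (A - B) + 0 * norm A)"
  proof (rule eigvec_perturbation[OF A B, where S = "mat 1"])
    show "\<bar>y \<bullet> (B *v y) - (mat 1 *v y) \<bullet> (A *v (mat 1 *v y))\<bar> \<le> norm (A - B) * (y \<bullet> y)" for y
      using abs_quadratic_form_le[of y "A - B"]
      by (simp add: matrix_vector_mult_diff_rdistrib inner_diff_right abs_minus_commute)
  qed simp_all
  then show ?thesis by simp
qed

lemma norm_vec_le_of_components:
  fixes x :: "'a::real_normed_vector^'n"
  assumes "\<And>i. norm (x $ i) \<le> c"
  shows "norm x \<le> real CARD('n) * c"
proof -
  have "norm x \<le> (\<Sum>i\<in>UNIV. norm (x $ i))"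
    unfolding norm_vec_def by (rule L2_set_le_sum) simp
  also have "\<dots> \<le> (\<Sum>i\<in>(UNIV::'n set). c)"
    by (intro sum_mono assms)
  finally show ?thesis by simp
qed

lemma eigvec_lipschitz:
  fixes A B :: "real^'n::{finite,linorder}^'n::{finite,linorder}"
  assumes "A \<in> sym_mats" "B \<in> sym_mats"
  shows "norm (eigvec A - eigvec B) \<le> real CARD('n) * norm (A - B)"
  using eigvec_lipschitz_component[OF assms] by (intro norm_vec_le_of_components) simp

lemma abs_entry_orthogonal_le:
  fixes U :: "real^'n^'n"
  assumes "orthogonal_matrix U"
  shows "\<bar>U $ i $ j\<bar> \<le> 1"
  using norm_column_orthogonal[OF assms, of j] component_le_norm_cart[of "column j U" i]
  by (simp add: column_def)

text \<open>A crude constant: one factor \<open>CARD('n)\<close> from the sum in each entry and one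
  for each of the two indices.\<close>

lemma norm_spec_le:
  fixes U :: "real^'n^'n"
  assumes "orthogonal_matrix U"
  shows "norm (spec U d) \<le> real CARD('n) ^ 3 * norm d"
proof -
  have "\<bar>U $ i $ k * d $ k * U $ j $ k\<bar> \<le> 1 * norm d * 1" for i j k
    unfolding abs_mult using abs_entry_orthogonal_le[OF assms] component_le_norm_cart[of d k]
    by (intro mult_mono) auto
  then have "\<bar>U $ i $ k * d $ k * U $ j $ k\<bar> \<le> norm d" for i j k by simp
  then have "(\<Sum>k\<in>UNIV. \<bar>U $ i $ k * d $ k * U $ j $ k\<bar>) \<le> (\<Sum>k\<in>(UNIV::'n set). norm d)" for i j
    by (intro sum_mono)
  then have "norm (spec U d $ i $ j) \<le> real CARD('n) * norm d" for i j
    by (simp add: spec_def order_trans[OF sum_abs])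
  then have "norm (spec U d) \<le> real CARD('n) * (real CARD('n) * (real CARD('n) * norm d))"
    by (intro norm_vec_le_of_components)
  then show ?thesis by (simp add: power3_eq_cube mult_ac)
qed

section \<open>Symmetric matrices as a closed subspace\<close>

lemma sym_mats_scaleR: "A \<in> sym_mats \<Longrightarrow> c *\<^sub>R A \<in> sym_mats"
  by (simp add: sym_mats_def transpose_def vec_eq_iff)

lemma sym_mats_add: "A \<in> sym_mats \<Longrightarrow> B \<in> sym_mats \<Longrightarrow> A + B \<in> sym_mats"
  by (simp add: sym_mats_def transpose_def vec_eq_iff)

lemma sym_mats_diff: "A \<in> sym_mats \<Longrightarrow> B \<in> sym_mats \<Longrightarrow> A - B \<in> sym_mats"
  by (simp add: sym_mats_def transpose_def vec_eq_iff)

lemma closed_sym_mats: "closed (sym_mats :: (real^'n^'n) set)"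
proof -
  have eq: "sym_mats = (\<Inter>i. \<Inter>j. {X :: real^'n^'n. X $ j $ i = X $ i $ j})"
    by (auto simp: sym_mats_def transpose_def vec_eq_iff)
  show ?thesis
    unfolding eq by (intro closed_INT ballI closed_Collect_eq continuous_intros)
qed

lemma eigvec_tendsto:
  fixes A :: "'a \<Rightarrow> real^'n::{finite,linorder}^'n::{finite,linorder}"
  assumes "(A \<longlongrightarrow> L) F" "\<forall>\<^sub>F t in F. A t \<in> sym_mats" "L \<in> sym_mats"
  shows "((\<lambda>t. eigvec (A t)) \<longlongrightarrow> eigvec L) F"
proof (rule Lim_null_comparison[THEN LIM_zero_cancel])
  show "\<forall>\<^sub>F t in F. norm (eigvec (A t) - eigvec L) \<le> real CARD('n) * norm (A t - L)"
    using assms(2) by eventually_elim (rule eigvec_lipschitz[OF _ assms(3)])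
  have "((\<lambda>t. norm (A t - L)) \<longlongrightarrow> 0) F"
    using assms(1) by (simp add: LIM_zero tendsto_norm_zero)
  then show "((\<lambda>t. real CARD('n) * norm (A t - L)) \<longlongrightarrow> 0) F"
    by (rule tendsto_mult_right_zero)
qed

section \<open>One-sided limits from finite level sets\<close>

text \<open>Intermediate value theorem: on a short interval to the right of 0 the image of
  \<open>f\<close> is connected and misses \<open>c\<close>, so it lies on one side.\<close>

lemma eventually_sign:
  fixes f :: "real \<Rightarrow> real"
  assumes "\<forall>\<^sub>F t in at_right 0. isCont f t" "\<forall>\<^sub>F t in at_right 0. f t \<noteq> c"
  shows "(\<forall>\<^sub>F t in at_right 0. f t > c) \<or> (\<forall>\<^sub>F t in at_right 0. f t < c)"
proof -
  obtain e where e: "e > 0" "\<And>t. 0 < t \<Longrightarrow> t < e \<Longrightarrow> isCont f t \<and> f t \<noteq> c"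
    using eventually_conj[OF assms] unfolding eventually_at_right_field by auto
  have "connected (f ` {0<..<e})"
    using e(2) by (intro connected_continuous_image continuous_at_imp_continuous_on) auto
  then have "\<not> (f s < c \<and> c < f t)" if "s \<in> {0<..<e}" "t \<in> {0<..<e}" for s t
    using connectedD_interval[of "f ` {0<..<e}" "f s" "f t" c] e(2) that by fastforce
  then have "(\<forall>t\<in>{0<..<e}. f t > c) \<or> (\<forall>t\<in>{0<..<e}. f t < c)"
    using e(2) by (metis greaterThanLessThan_iff linorder_neqE_linordered_idom)
  then show ?thesis
    using e(1) unfolding eventually_at_right_field by (metis greaterThanLessThan_iff)
qed

text \<open>If the lower and upper limits differed, \<open>f\<close> would cross every level between
  them arbitrarily close to 0, but only levels in the finite set \<open>F\<close> can be met again
  and again.\<close>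

lemma tendsto_of_eventually_avoiding:
  fixes f :: "real \<Rightarrow> real"
  assumes cont: "\<forall>\<^sub>F t in at_right 0. isCont f t"
    and bound: "\<forall>\<^sub>F t in at_right 0. \<bar>f t\<bar> \<le> B"
    and "finite F" and avoid: "\<And>c. c \<notin> F \<Longrightarrow> \<forall>\<^sub>F t in at_right 0. f t \<noteq> c"
  obtains L where "(f \<longlongrightarrow> L) (at_right 0)"
proof -
  \<comment> \<open>The supremum \<open>L\<close> of the eventual lower bounds is the lower limit of
    \<open>f\<close>.\<close>
  define T where "T = {c. \<forall>\<^sub>F t in at_right 0. f t \<ge> c}"
  define L where "L = Sup T"
  have "- B \<in> T"
    using bound unfolding T_def by (auto elim: eventually_mono)
  have "c \<le> B" if "c \<in> T" for c
  proof -
    have "\<forall>\<^sub>F t in at_right (0::real). c \<le> B"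
      using that bound unfolding T_def mem_Collect_eq by eventually_elim linarith
    then show ?thesis by (simp add: eventually_const_iff)
  qed
  then have "bdd_above T" by (rule bdd_aboveI)
  have lower: "\<forall>\<^sub>F t in at_right 0. f t > a" if "a < L" for a
  proof -
    obtain c where "c \<in> T" "a < c"
      using \<open>a < L\<close> \<open>- B \<in> T\<close> less_cSupD[of T a] unfolding L_def by blast
    then show ?thesis unfolding T_def by (auto elim: eventually_mono)
  qed
  have upper: "\<forall>\<^sub>F t in at_right 0. f t < a" if "L < a" for a
  proof -
    \<comment> \<open>Some level between \<open>L\<close> and \<open>a\<close> is outside
      \<open>F\<close>. Staying above it would contradict the choice of \<open>L\<close>, so
      \<open>f\<close> stays below it.\<close>
    have "infinite {L<..<a}" using that by simp
    then obtain c where c: "L < c" "c < a" "c \<notin> F"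
      using \<open>finite F\<close> by (metis finite_subset greaterThanLessThan_iff subsetI)
    have "\<not> (\<forall>\<^sub>F t in at_right 0. f t > c)"
    proof
      assume "\<forall>\<^sub>F t in at_right 0. f t > c"
      then have "c \<in> T" unfolding T_def by (auto elim: eventually_mono)
      then have "c \<le> L" unfolding L_def using \<open>bdd_above T\<close> by (rule cSup_upper)
      then show False using c by simp
    qed
    then have "\<forall>\<^sub>F t in at_right 0. f t < c"
      using eventually_sign[OF cont avoid[OF c(3)]] by blast
    then show ?thesis by eventually_elim (use c in simp)
  qed
  show thesis
    by (rule that[of L], rule order_tendstoI) (use lower upper in auto)
qed

lemma eventually_poly_nonzero:
  fixes p :: "real poly"
  assumes "p \<noteq> 0"
  shows "\<forall>\<^sub>F t in at_right 0. poly p t \<noteq> 0"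
proof -
  \<comment> \<open>A possible root at 0 is kept in the open set, so that \<open>?S\<close> is a
    neighbourhood of 0; \<open>at_right 0\<close> ignores that point anyway.\<close>
  let ?S = "- ({t. poly p t = 0} - {0})"
  have "open ?S"
    using poly_roots_finite[OF assms] by (intro open_Compl finite_imp_closed) simp
  then have "\<forall>\<^sub>F t in at_right 0. t \<in> ?S"
    by (rule topological_tendstoD[OF tendsto_ident_at]) simp
  moreover have "\<forall>\<^sub>F t in at_right (0::real). 0 < t"
    by (rule eventually_at_right_less)
  ultimately show ?thesis by eventually_elim auto
qed

section \<open>Sorting along a line\<close>

text \<open>An affine function is either identically zero or of one strict sign to the right of 0,
  so frequent and eventual nonnegativity coincide.\<close>

lemma affine_frequently_nonneg:
  fixes a b :: real
  assumes "\<exists>\<^sub>F t in at_right 0. 0 \<le> a + t * b"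
  shows "\<forall>\<^sub>F t in at_right 0. 0 \<le> a + t * b"
proof (cases "[:a, b:] = 0")
  case False
  have poly_eq: "poly [:a, b:] t = a + t * b" for t
    by simp
  have "(\<forall>\<^sub>F t in at_right 0. poly [:a, b:] t > 0) \<or> (\<forall>\<^sub>F t in at_right 0. poly [:a, b:] t < 0)"
    by (rule eventually_sign[OF _ eventually_poly_nonzero[OF False]]) simp
  then show ?thesis
    using assms unfolding poly_eq frequently_def not_le by (auto elim: eventually_mono)
qed simp

text \<open>Each \<open>t\<close> is sorted by one of finitely many permutations, so some \<sigma>
  works arbitrarily close to 0. Its order conditions are affine in \<open>t\<close>, hence hold for
  all small \<open>t\<close>.\<close>

lemma eigvec_spec_line:
  fixes U :: "real^'n::{finite,linorder}^'n::{finite,linorder}"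
  assumes U: "orthogonal_matrix U"
  obtains \<sigma> where "\<sigma> permutes UNIV"
    "\<forall>\<^sub>F t in at_right 0. eigvec (spec U (x + t *\<^sub>R v)) =
       (\<chi> i. (x + t *\<^sub>R v) $ \<sigma> i)"
proof -
  define p where "p t = x + t *\<^sub>R v" for t :: real
  define sorts where "sorts \<sigma> t \<longleftrightarrow> antitone_vec (\<chi> i. p t $ \<sigma> i)" for \<sigma> :: "'n \<Rightarrow> 'n" and t
  have "\<exists>\<sigma>. \<sigma> permutes UNIV \<and> (\<exists>\<^sub>F t in at_right 0. sorts \<sigma> t)"
  proof (rule ccontr)
    assume "\<nexists>\<sigma>. \<sigma> permutes UNIV \<and> (\<exists>\<^sub>F t in at_right 0. sorts \<sigma> t)"
    then have "\<forall>\<sigma>\<in>{\<sigma>. \<sigma> permutes UNIV}. \<forall>\<^sub>F t in at_right 0. \<not> sorts \<sigma> t"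
      by (simp add: frequently_def)
    then have "\<forall>\<^sub>F t in at_right (0::real). \<forall>\<sigma>\<in>{\<sigma>. \<sigma> permutes UNIV}. \<not> sorts \<sigma> t"
      by (intro eventually_ball_finite finite_permutations finite)
    moreover have ex: "\<exists>\<sigma>\<in>{\<sigma>. \<sigma> permutes UNIV}. sorts \<sigma> t" for t
      using eigvec_spec_permutes[OF U, of "p t"] antitone_eigvec_spec[OF U, of "p t"]
      unfolding sorts_def by (metis mem_Collect_eq)
    ultimately have "\<forall>\<^sub>F t in at_right (0::real). False"
      by (metis (mono_tags, lifting) eventually_mono)
    then show False by simp
  qed
  then obtain \<sigma> where \<sigma>: "\<sigma> permutes UNIV" "\<exists>\<^sub>F t in at_right 0. sorts \<sigma> t"
    by blast
  have "\<forall>\<^sub>F t in at_right 0. p t $ \<sigma> j \<le> p t $ \<sigma> i" if "i \<le> j" for i j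
  proof -
    have diff: "p t $ \<sigma> i - p t $ \<sigma> j =
        (x $ \<sigma> i - x $ \<sigma> j) + t * (v $ \<sigma> i - v $ \<sigma> j)" for t
      unfolding p_def vector_add_component vector_scaleR_component real_scaleR_def
      by (simp only: ring_distribs)
    have "\<exists>\<^sub>F t in at_right 0. 0 \<le> p t $ \<sigma> i - p t $ \<sigma> j"
      using \<sigma>(2) by (rule frequently_elim1) (use that in \<open>auto simp: sorts_def antitone_vec_def\<close>)
    then have "\<forall>\<^sub>F t in at_right 0. 0 \<le> p t $ \<sigma> i - p t $ \<sigma> j"
      unfolding diff by (rule affine_frequently_nonneg)
    then show ?thesis by eventually_elim simp
  qed
  then have "\<forall>\<^sub>F t in at_right 0. \<forall>i j. i \<le> j \<longrightarrow> p t $ \<sigma> j \<le> p t $ \<sigma> i"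
    by (intro eventually_all_finite) (auto intro: eventually_mono)
  then have "\<forall>\<^sub>F t in at_right 0. eigvec (spec U (p t)) = (\<chi> i. p t $ \<sigma> i)"
  proof eventually_elim
    case (elim t)
    then have "antitone_vec (\<chi> i. p t $ \<sigma> i)" by (simp add: antitone_vec_def)
    then show ?case
      using eigvec_spec_antitone[OF orthogonal_matrix_permute[OF U \<sigma>(1)]] spec_permute[OF \<sigma>(1), of U "p t"]
      by metis
  qed
  with \<sigma>(1) show thesis unfolding p_def by (rule that)
qed

section \<open>The first directional derivative\<close>

lemma matrix_mult_minus_left:
  fixes A :: "real^'n^'m" and B :: "real^'k^'n"
  shows "(- A) ** B = - (A ** B)"
  by (simp add: matrix_matrix_mult_def vec_eq_iff sum_negf)

lemma matrix_mult_minus_right: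
  fixes A :: "real^'n^'m" and B :: "real^'k^'n"
  shows "A ** (- B) = - (A ** B)"
  by (simp add: matrix_matrix_mult_def vec_eq_iff sum_negf)

lemma matrix_mult_distribs:
  fixes A A' :: "real^'n^'m" and B B' :: "real^'k^'n"
  shows "(A + A') ** B = A ** B + A' ** B" "(A - A') ** B = A ** B - A' ** B"
    "A ** (B + B') = A ** B + A ** B'" "A ** (B - B') = A ** B - A ** B'"
  by (simp_all add: matrix_matrix_mult_def vec_eq_iff algebra_simps sum.distrib sum_subtractf)

text \<open>Adding the commutator of \<open>X\<close> with a skew \<open>K\<close> removes the part
  of \<open>H\<close> that couples different eigenspaces of \<open>X\<close>. Inside each eigenspace
  \<open>U\<close> already diagonalises \<open>H\<close>, so the same \<open>U\<close> serves both
  matrices.\<close>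

lemma first_order_block_reduction:
  fixes X H :: "real^'n^'n"
  assumes X: "X \<in> sym_mats" and H: "H \<in> sym_mats"
  obtains U x h K where "orthogonal_matrix U" "X = spec U x" "transpose K = - K"
    "spec U h = H + X ** K - K ** X"
proof -
  obtain U where U: "orthogonal_matrix U"
    "\<And>i j. i \<noteq> j \<Longrightarrow> (transpose U ** X ** U) $ i $ j = 0"
    "\<And>i j. i \<noteq> j \<Longrightarrow> (transpose U ** X ** U) $ i $ i = (transpose U ** X ** U) $ j $ j
       \<Longrightarrow> (transpose U ** H ** U) $ i $ j = 0"
    using orthogonal_diagonalization_pair[of X H] X H unfolding sym_mats_def by blast
  have UU: "U ** transpose U = mat 1" "transpose U ** U = mat 1"
    using U(1) by (simp_all add: orthogonal_matrix_def)
  define X' where "X' = transpose U ** X ** U"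
  define H' where "H' = transpose U ** H ** U"
  define x where "x = (\<chi> i. X' $ i $ i)"
  \<comment> \<open>In the eigenbasis the commutator has entries
    \<open>(x $ i - x $ j) * K' $ i $ j\<close>, so this quotient cancels \<open>H' $ i $ j\<close>.
    Where the eigenvalues coincide nothing is left to cancel off the diagonal, and the entry is
    0.\<close>
  define K' :: "real^'n^'n" where
    "K' = (\<chi> i j. if x $ i = x $ j then 0 else H' $ i $ j / (x $ j - x $ i))"
  define K where "K = U ** K' ** transpose U"
  have X'x: "X' $ i $ j = (if i = j then x $ i else 0)" for i j
    using U(2) by (simp add: x_def X'_def)
  have "transpose H' = H'"
    using H by (simp add: H'_def sym_mats_def matrix_transpose_mul matrix_mul_assoc)
  then have H'sym: "H' $ i $ j = H' $ j $ i" for i j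
    by (metis transpose_def vec_lambda_beta)
  have "transpose K' = - K'"
    by (simp add: vec_eq_iff transpose_def K'_def H'sym divide_simps)
      (simp add: algebra_simps)
  then have K: "transpose K = - K"
    by (simp add: K_def matrix_transpose_mul matrix_mul_assoc matrix_mult_minus_left matrix_mult_minus_right)
  define M where "M = H + X ** K - K ** X"
  have UUZ: "transpose U ** (U ** Z) = Z" for Z :: "real^'n^'n"
    by (simp add: matrix_mul_assoc UU)
  have "transpose U ** M ** U = H' + X' ** K' - K' ** X'"
    by (simp add: M_def H'_def X'_def K_def matrix_mul_assoc[symmetric] matrix_mult_distribs UU UUZ)
  moreover have "(X' ** K') $ i $ j = x $ i * K' $ i $ j" "(K' ** X') $ i $ j = K' $ i $ j * x $ j" for i j
    by (simp_all add: matrix_matrix_mult_def X'x if_distrib[of "\<lambda>z. z * _"] if_distrib[of "(*) _"] cong: if_cong)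
  ultimately have entry: "(transpose U ** M ** U) $ i $ j = H' $ i $ j + (x $ i - x $ j) * K' $ i $ j" for i j
    by (simp add: left_diff_distrib mult.commute[of "K' $ i $ j" "x $ j"])
  have zero: "H' $ i $ j = 0" if "i \<noteq> j" "x $ i = x $ j" for i j
    using U(3) that by (simp add: x_def H'_def X'_def)
  have solve: "(x $ i - x $ j) * K' $ i $ j = - H' $ i $ j" if "x $ i \<noteq> x $ j" for i j
    using that by (simp add: K'_def field_simps)
  have M': "(transpose U ** M ** U) $ i $ j = (if i = j then H' $ i $ i else 0)" for i j
    unfolding entry using zero[of i j] solve[of i j] by (cases "x $ i = x $ j") auto
  have "M = spec U (\<chi> i. (transpose U ** M ** U) $ i $ i)"
    by (rule spec_of_diagonal_conj[OF U(1)]) (simp add: M')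
  moreover have "X = spec U x"
    unfolding x_def X'_def by (rule spec_of_diagonal_conj[OF U(1,2)])
  ultimately show thesis
    using that[OF U(1) _ K, of x "\<chi> i. (transpose U ** M ** U) $ i $ i"] by (simp add: M_def)
qed

text \<open>Since K^T = -K, expanding S^T (X + t H) S gives X + t G + O(t^2), and S^T S = 1 - t^2
  K^2. Both errors are bounded explicitly; \<open>t \<le> 1\<close> absorbs the cubic term.\<close>

lemma congruence_form_bound:
  fixes X H K :: "real^'n^'n"
  assumes X: "transpose X = X" and H: "transpose H = H" and K: "transpose K = - K"
    and t: "0 \<le> t" "t \<le> 1"
  defines "S \<equiv> mat 1 + t *\<^sub>R K" and "G \<equiv> H + X ** K - K ** X"
  shows "\<bar>y \<bullet> ((X + t *\<^sub>R G) *v y) - (S *v y) \<bullet> ((X + t *\<^sub>R H) *v (S *v y))\<bar>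
      \<le> t\<^sup>2 * (norm X * (norm K)\<^sup>2 + 2 * norm K * norm H + norm H * (norm K)\<^sup>2) * (y \<bullet> y)" (is ?form)
    and "\<bar>(S *v y) \<bullet> (S *v y) - y \<bullet> y\<bar> \<le> t\<^sup>2 * (norm K)\<^sup>2 * (y \<bullet> y)" (is ?isom)
proof -
  define z where "z = K *v y"
  have skew: "u \<bullet> (K *v w) = - ((K *v u) \<bullet> w)" for u w
  proof -
    have "u \<bullet> (K *v w) = (transpose K *v u) \<bullet> w"
      by (metis dot_lmul_matrix vector_transpose_matrix transpose_transpose)
    then show ?thesis by (simp add: K matrix_vector_mult_minus_left)
  qed
  have Sy: "S *v y = y + t *\<^sub>R z"
    by (simp add: S_def z_def matrix_vector_mult_add_rdistrib scaleR_matrix_vector_assoc)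
  \<comment> \<open>Skewness removes the term of order \<open>t\<close> from the squared length of
    \<open>S y\<close>.\<close>
  have yz: "y \<bullet> z = 0"
    using skew[of y y] by (simp add: z_def inner_commute)
  have "norm z \<le> norm K * norm y"
    unfolding z_def by (rule matrix_vector_norm_le)
  then have zz: "z \<bullet> z \<le> (norm K)\<^sup>2 * (y \<bullet> y)"
    using power_mono[of "norm z" "norm K * norm y" 2] by (simp add: dot_square_norm power_mult_distrib)
  have "(S *v y) \<bullet> (S *v y) - y \<bullet> y = t\<^sup>2 * (z \<bullet> z)"
    by (simp add: Sy inner_add_left inner_add_right yz inner_commute[of z y] power2_eq_square)
  then show ?isom
    using mult_left_mono[OF zz, of "t\<^sup>2"] by (simp add: abs_mult mult.assoc)
  have G: "y \<bullet> (G *v y) = y \<bullet> (H *v y) + 2 * (z \<bullet> (X *v y))"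
    using skew[of y "X *v y"] symmetric_form_swap[OF X, of y z]
    by (simp add: G_def z_def matrix_vector_mult_add_rdistrib matrix_vector_mult_diff_rdistrib
        inner_add_right inner_diff_right flip: matrix_vector_mul_assoc)
  have "y \<bullet> ((X + t *\<^sub>R G) *v y) - (S *v y) \<bullet> ((X + t *\<^sub>R H) *v (S *v y))
    = - (t\<^sup>2 * (z \<bullet> (X *v z) + 2 * (z \<bullet> (H *v y)) + t * (z \<bullet> (H *v z))))"
    using symmetric_form_swap[OF X, of y z] symmetric_form_swap[OF H, of y z] G
    by (simp add: Sy matrix_vector_mult_add_rdistrib matrix_vector_right_distrib matrix_vector_mult_scaleR
        inner_add_left inner_add_right algebra_simps power2_eq_square flip: scaleR_matrix_vector_assoc)
  also have "\<bar>\<dots>\<bar> = t\<^sup>2 * \<bar>z \<bullet> (X *v z) + 2 * (z \<bullet> (H *v y)) + t * (z \<bullet> (H *v z))\<bar>"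
    by (simp add: abs_mult)
  also have "\<dots> \<le> t\<^sup>2 * ((norm X * (norm K)\<^sup>2 + 2 * norm K * norm H + norm H * (norm K)\<^sup>2) * (y \<bullet> y))"
  proof (rule mult_left_mono)
    have 1: "\<bar>z \<bullet> (X *v z)\<bar> \<le> norm X * ((norm K)\<^sup>2 * (y \<bullet> y))"
      using abs_quadratic_form_le[of z X] mult_left_mono[OF zz, of "norm X"] by simp
    have "\<bar>t * (z \<bullet> (H *v z))\<bar> \<le> 1 * \<bar>z \<bullet> (H *v z)\<bar>"
      unfolding abs_mult using t by (intro mult_right_mono) auto
    then have 2: "\<bar>t * (z \<bullet> (H *v z))\<bar> \<le> norm H * ((norm K)\<^sup>2 * (y \<bullet> y))"
      using abs_quadratic_form_le[of z H] mult_left_mono[OF zz, of "norm H"] by simp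
    have "\<bar>z \<bullet> (H *v y)\<bar> \<le> norm z * norm (H *v y)"
      by (rule Cauchy_Schwarz_ineq2)
    also have "\<dots> \<le> (norm K * norm y) * (norm H * norm y)"
      by (intro mult_mono matrix_vector_norm_le \<open>norm z \<le> norm K * norm y\<close>) auto
    finally have 3: "\<bar>z \<bullet> (H *v y)\<bar> \<le> norm K * norm H * (y \<bullet> y)"
      by (simp add: dot_square_norm power2_eq_square mult_ac)
    show "\<bar>z \<bullet> (X *v z) + 2 * (z \<bullet> (H *v y)) + t * (z \<bullet> (H *v z))\<bar>
      \<le> (norm X * (norm K)\<^sup>2 + 2 * norm K * norm H + norm H * (norm K)\<^sup>2) * (y \<bullet> y)"
      using 1 2 3 by (simp add: algebra_simps abs_le_iff)
  qed simp
  finally show ?form by (simp add: mult.assoc)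
qed

text \<open>\<open>X + t H\<close> is compared by the congruence with
  \<open>spec U (x + t h)\<close>, whose ordered eigenvalues are exactly affine for small
  \<open>t > 0\<close>.\<close>

lemma eigvec_first_order_expansion:
  fixes X H :: "real^'n::{finite,linorder}^'n::{finite,linorder}"
  assumes X: "X \<in> sym_mats" and H: "H \<in> sym_mats"
  obtains b M where "\<forall>\<^sub>F t in at_right 0. \<forall>i. \<bar>eigvec (X + t *\<^sub>R H) $ i - eigvec X $ i - t * b $ i\<bar> \<le> M * t\<^sup>2"
proof -
  obtain U x h K where U: "orthogonal_matrix U" and Xx: "X = spec U x" and K: "transpose K = - K"
    and h: "spec U h = H + X ** K - K ** X"
    using first_order_block_reduction[OF X H] .
  obtain \<sigma> where "\<sigma> permutes UNIV"
    and ev: "\<forall>\<^sub>F t in at_right 0. eigvec (spec U (x + t *\<^sub>R h)) = (\<chi> i. (x + t *\<^sub>R h) $ \<sigma> i)"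
    using eigvec_spec_line[OF U, of x h] .
  have G: "X + t *\<^sub>R (H + X ** K - K ** X) = spec U (x + t *\<^sub>R h)" for t
    by (simp add: Xx[symmetric] h[symmetric] spec_add spec_scaleR)
  have sorted: "\<forall>\<^sub>F t in at_right 0. eigvec (spec U (x + t *\<^sub>R h)) = (\<chi> i. x $ \<sigma> i + t * h $ \<sigma> i)"
    using ev by simp
  \<comment> \<open>The permutation that sorts the line for small \<open>t > 0\<close> also sorts
    its starting point, by letting \<open>t\<close> tend to 0.\<close>
  have "eigvec X = (\<chi> i. x $ \<sigma> i)"
  proof (rule tendsto_unique)
    have "((\<lambda>t. spec U (x + t *\<^sub>R h)) \<longlongrightarrow> X + 0 *\<^sub>R (H + X ** K - K ** X)) (at_right 0)"
      unfolding G[symmetric] by (intro tendsto_intros)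
    then show "((\<lambda>t. eigvec (spec U (x + t *\<^sub>R h))) \<longlongrightarrow> eigvec X) (at_right 0)"
      by (intro eigvec_tendsto X) (simp_all add: spec_in_sym_mats)
    have "((\<lambda>t. \<chi> i. x $ \<sigma> i + t * h $ \<sigma> i) \<longlongrightarrow> (\<chi> i. x $ \<sigma> i + 0 * h $ \<sigma> i)) (at_right 0)"
      by (intro tendsto_intros)
    then show "((\<lambda>t. eigvec (spec U (x + t *\<^sub>R h))) \<longlongrightarrow> (\<chi> i. x $ \<sigma> i)) (at_right 0)"
      using tendsto_cong[OF sorted] by simp
  qed simp
  \<comment> \<open>\<open>N\<close> is the form error of \<open>congruence_form_bound\<close>;
    \<open>M\<close> adds the isometry defect times a bound for the norm of
    \<open>X + t H\<close>.\<close>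
  define N where "N = norm X * (norm K)\<^sup>2 + 2 * norm K * norm H + norm H * (norm K)\<^sup>2"
  define M where "M = N + (norm K)\<^sup>2 * (norm X + norm H)"
  have "\<forall>\<^sub>F t::real in at_right 0. 0 < t \<and> t < 1"
    by (simp add: eventually_at_right_field) (use zero_less_one in blast)
  with sorted have "\<forall>\<^sub>F t in at_right 0. \<forall>i. \<bar>eigvec (X + t *\<^sub>R H) $ i - eigvec X $ i - t * (\<chi> i. h $ \<sigma> i) $ i\<bar> \<le> M * t\<^sup>2"
  proof eventually_elim
    case (elim t)
    show ?case
    proof
      fix i
      have "norm (X + t *\<^sub>R H) \<le> norm X + t * norm H"
        using norm_triangle_ineq[of X "t *\<^sub>R H"] elim by simp
      also have "\<dots> \<le> norm X + norm H"
        using mult_right_mono[of t 1 "norm H"] elim by simp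
      finally have "t\<^sup>2 * (norm K)\<^sup>2 * norm (X + t *\<^sub>R H) \<le> t\<^sup>2 * (norm K)\<^sup>2 * (norm X + norm H)"
        by (intro mult_left_mono) auto
      moreover have "\<bar>eigvec (X + t *\<^sub>R H) $ i - eigvec (spec U (x + t *\<^sub>R h)) $ i\<bar>
          \<le> t\<^sup>2 * N + t\<^sup>2 * (norm K)\<^sup>2 * norm (X + t *\<^sub>R H)"
        unfolding N_def using elim X H
        by (intro eigvec_perturbation[where S = "mat 1 + t *\<^sub>R K"] sym_mats_add sym_mats_scaleR spec_in_sym_mats)
          (auto simp flip: G simp: sym_mats_def intro!: congruence_form_bound K)
      moreover have "t\<^sup>2 * N + t\<^sup>2 * (norm K)\<^sup>2 * (norm X + norm H) = M * t\<^sup>2"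
        by (simp add: M_def algebra_simps)
      moreover have "eigvec (X + t *\<^sub>R H) $ i - eigvec X $ i - t * (\<chi> i. h $ \<sigma> i) $ i
          = eigvec (X + t *\<^sub>R H) $ i - eigvec (spec U (x + t *\<^sub>R h)) $ i"
        using elim \<open>eigvec X = _\<close> by simp
      ultimately show "\<bar>eigvec (X + t *\<^sub>R H) $ i - eigvec X $ i - t * (\<chi> i. h $ \<sigma> i) $ i\<bar> \<le> M * t\<^sup>2"
        by linarith
    qed
  qed
  then show thesis by (rule that)
qed

text \<open>The slope \<open>b\<close> is the limit of the difference quotient, so
  \<open>Lim\<close> in \<open>eig_dir1\<close> evaluates to it and the quadratic remainder is
  inherited.\<close>

lemma eig_dir1_expansion:
  fixes X H :: "real^'n::{finite,linorder}^'n::{finite,linorder}"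
  assumes X: "X \<in> sym_mats" and H: "H \<in> sym_mats"
  obtains M where
    "\<forall>\<^sub>F t in at_right 0. \<forall>i. \<bar>eigvec (X + t *\<^sub>R H) $ i - eigvec X $ i - t * eig_dir1 X H $ i\<bar> \<le> M * t\<^sup>2"
proof -
  obtain b M where bM: "\<forall>\<^sub>F t in at_right 0. \<forall>i. \<bar>eigvec (X + t *\<^sub>R H) $ i - eigvec X $ i - t * b $ i\<bar> \<le> M * t\<^sup>2"
    using eigvec_first_order_expansion[OF X H] .
  have "((\<lambda>t. (1 / t) *\<^sub>R (eigvec (X + t *\<^sub>R H) - eigvec X)) \<longlongrightarrow> b) (at_right 0)"
  proof (rule vec_tendstoI, rule Lim_null_comparison[THEN LIM_zero_cancel])
    fix i
    have "\<forall>\<^sub>F t::real in at_right 0. 0 < t" by (rule eventually_at_right_less)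
    with bM show "\<forall>\<^sub>F t in at_right 0.
        norm (((1 / t) *\<^sub>R (eigvec (X + t *\<^sub>R H) - eigvec X)) $ i - b $ i) \<le> M * t"
    proof eventually_elim
      case (elim t)
      have "((1 / t) *\<^sub>R (eigvec (X + t *\<^sub>R H) - eigvec X)) $ i - b $ i
          = (eigvec (X + t *\<^sub>R H) $ i - eigvec X $ i - t * b $ i) / t"
        using elim by (simp add: field_simps)
      then show ?case
        using elim by (simp add: abs_divide pos_divide_le_eq power2_eq_square mult.assoc)
    qed
    show "((\<lambda>t. M * t) \<longlongrightarrow> 0) (at_right 0)"
      by (auto intro!: tendsto_eq_intros)
  qed
  then have "eig_dir1 X H = b"
    unfolding eig_dir1_def by (intro tendsto_Lim) simp_all
  with bM show thesis by (intro that) simp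
qed

section \<open>The second directional derivative\<close>

lemma poly_det:
  fixes M :: "'a::comm_ring_1 poly^'n^'n"
  shows "poly (det M) t = det (\<chi> i j. poly (M $ i $ j) t)"
  by (simp add: det_def poly_sum poly_prod)

text \<open>An eigenvalue branch meets the parabola \<open>a + b t + c t\<^sup>2 / 2\<close> only at roots of a polynomial
  in \<open>t\<close>, and this polynomial vanishes identically for at most finitely many \<open>c\<close>.\<close>

lemma eigvec_avoids_parabolas:
  fixes X H W :: "real^'n::{finite,linorder}^'n::{finite,linorder}"
  assumes X: "X \<in> sym_mats" and H: "H \<in> sym_mats" and W: "W \<in> sym_mats"
  obtains F where "finite F"
    "\<And>c. c \<notin> F \<Longrightarrow> \<forall>\<^sub>F t in at_right 0. eigvec (X + t *\<^sub>R H + (t\<^sup>2 / 2) *\<^sub>R W) $ i \<noteq> a + t * b + t\<^sup>2 / 2 * c"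
proof -
  define A where "A t = X + t *\<^sub>R H + (t\<^sup>2 / 2) *\<^sub>R W" for t
  have A: "A t \<in> sym_mats" for t
    unfolding A_def using assms by (intro sym_mats_add sym_mats_scaleR)
  \<comment> \<open>The characteristic determinant of \<open>A t\<close> at the parabola, kept as a
    polynomial in \<open>t\<close>.\<close>
  define q where "q c = det (\<chi> i j. (if i = j then [:a, b, c / 2:] else 0) - [:X $ i $ j, H $ i $ j, W $ i $ j / 2:])" for c
  have "(\<chi> i j. poly ((if i = j then [:a, b, c / 2:] else 0) - [:X $ i $ j, H $ i $ j, W $ i $ j / 2:]) t)
      = mat (a + t * b + t\<^sup>2 / 2 * c) - A t" for c t
    by (simp add: vec_eq_iff A_def mat_def power2_eq_square distrib_left)
  then have poly_q: "poly (q c) t = det (mat (a + t * b + t\<^sup>2 / 2 * c) - A t)" for c t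
    by (simp add: q_def poly_det)
  have det_A: "det (mat s - A t) = (\<Prod>k\<in>UNIV. s - eigvec (A t) $ k)" for s t
    using spectral_theorem[OF A[of t]] det_mat_minus_spec by metis
  \<comment> \<open>\<open>q c\<close> is shown to be nonzero by evaluation at \<open>t = 1\<close>,
    where it vanishes exactly if \<open>a + b + c / 2\<close> is an eigenvalue of
    \<open>A 1\<close>; \<open>F\<close> collects these \<open>c\<close>.\<close>
  define F where "F = (\<lambda>k. 2 * (eigvec (A 1) $ k - a - b)) ` UNIV"
  show thesis
  proof (rule that[of F])
    fix c assume "c \<notin> F"
    then have "a + 1 * b + 1\<^sup>2 / 2 * c - eigvec (A 1) $ k \<noteq> 0" for k
      unfolding F_def by (force simp: field_simps)
    then have "poly (q c) 1 \<noteq> 0"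
      unfolding poly_q det_A by simp
    then have "q c \<noteq> 0" by auto
    then have "\<forall>\<^sub>F t in at_right 0. poly (q c) t \<noteq> 0"
      by (rule eventually_poly_nonzero)
    then show "\<forall>\<^sub>F t in at_right 0. eigvec (X + t *\<^sub>R H + (t\<^sup>2 / 2) *\<^sub>R W) $ i \<noteq> a + t * b + t\<^sup>2 / 2 * c"
      unfolding poly_q det_A A_def[symmetric] by eventually_elim (metis eq_iff_diff_eq_0 finite prod_zero_iff UNIV_I)
  qed (simp add: F_def)
qed

text \<open>Each component of the quotient is continuous for \<open>t > 0\<close>, bounded near 0,
  and avoids all but finitely many values, so \<open>tendsto_of_eventually_avoiding\<close>
  applies.\<close>

lemma eig_dir2_tendsto:
  fixes X H W :: "real^'n::{finite,linorder}^'n::{finite,linorder}"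
  assumes X: "X \<in> sym_mats" and H: "H \<in> sym_mats" and W: "W \<in> sym_mats"
  shows "((\<lambda>t. (1 / (t\<^sup>2 / 2)) *\<^sub>R (eigvec (X + t *\<^sub>R H + (t\<^sup>2 / 2) *\<^sub>R W) - eigvec X - t *\<^sub>R eig_dir1 X H))
    \<longlongrightarrow> eig_dir2 X H W) (at_right 0)"
proof -
  define A where "A t = X + t *\<^sub>R H + (t\<^sup>2 / 2) *\<^sub>R W" for t
  have A: "A t \<in> sym_mats" for t
    unfolding A_def using assms by (intro sym_mats_add sym_mats_scaleR)
  define f where "f t = (1 / (t\<^sup>2 / 2)) *\<^sub>R (eigvec (A t) - eigvec X - t *\<^sub>R eig_dir1 X H)" for t
  have pos: "\<forall>\<^sub>F t::real in at_right 0. 0 < t"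
    by (rule eventually_at_right_less)
  obtain M where M: "\<forall>\<^sub>F t in at_right 0. \<forall>i. \<bar>eigvec (X + t *\<^sub>R H) $ i - eigvec X $ i - t * eig_dir1 X H $ i\<bar> \<le> M * t\<^sup>2"
    using eig_dir1_expansion[OF X H] .
  have "\<exists>L. ((\<lambda>t. f t $ i) \<longlongrightarrow> L) (at_right 0)" for i
  proof -
    obtain F where F: "finite F" "\<And>c. c \<notin> F \<Longrightarrow>
        \<forall>\<^sub>F t in at_right 0. eigvec (A t) $ i \<noteq> eigvec X $ i + t * eig_dir1 X H $ i + t\<^sup>2 / 2 * c"
      by (rule eigvec_avoids_parabolas[OF assms, of i "eigvec X $ i" "eig_dir1 X H $ i", folded A_def], rule that, assumption, blast)
    have "isCont A t" for t
      unfolding A_def by (intro continuous_intros) simp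
    then have "isCont (\<lambda>t. eigvec (A t)) t" for t
      unfolding isCont_def by (intro eigvec_tendsto) (auto simp: A)
    then have "isCont (\<lambda>t. eigvec (A t) $ i) t" for t
      by (rule isCont_vec_nth)
    then have "isCont (\<lambda>t. f t $ i) t" if "t > 0" for t
      unfolding f_def vector_scaleR_component vector_minus_component real_scaleR_def
      using that by (intro isCont_mult isCont_divide isCont_diff isCont_power continuous_const continuous_ident) (auto simp: power2_eq_square)
    then have cont: "\<forall>\<^sub>F t in at_right 0. isCont (\<lambda>t. f t $ i) t"
      by (rule eventually_mono[OF pos])
    have f_component: "f t $ i = (eigvec (A t) $ i - eigvec X $ i - t * eig_dir1 X H $ i) / (t\<^sup>2 / 2)" for t
      by (simp add: f_def)
    \<comment> \<open>The first-order remainder along \<open>X + t H\<close> contributes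
      \<open>2 * M\<close> after division by t^2/2, and the Lipschitz bound for the shift by
      \<open>W\<close> contributes \<open>norm W\<close>.\<close>
    have bound: "\<forall>\<^sub>F t in at_right 0. \<bar>f t $ i\<bar> \<le> 2 * M + norm W"
      using M pos
    proof eventually_elim
      case (elim t)
      have split: "(2 * M + norm W) * (t\<^sup>2 / 2) = M * t\<^sup>2 + t\<^sup>2 / 2 * norm W"
        by (simp add: algebra_simps)
      have "\<bar>eigvec (A t) $ i - eigvec (X + t *\<^sub>R H) $ i\<bar> \<le> norm (A t - (X + t *\<^sub>R H))"
        using X H by (intro eigvec_lipschitz_component A sym_mats_add sym_mats_scaleR)
      also have "\<dots> = t\<^sup>2 / 2 * norm W"
        by (simp add: A_def)
      finally have "\<bar>eigvec (A t) $ i - eigvec X $ i - t * eig_dir1 X H $ i\<bar> \<le> (2 * M + norm W) * (t\<^sup>2 / 2)"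
        unfolding split using elim(1)[rule_format, of i] by linarith
      then have "\<bar>eigvec (A t) $ i - eigvec X $ i - t * eig_dir1 X H $ i\<bar> / (t\<^sup>2 / 2) \<le> 2 * M + norm W"
        using elim(2) by (subst pos_divide_le_eq) simp_all
      then show ?case
        unfolding f_component abs_divide by simp
    qed
    have avoid: "\<forall>\<^sub>F t in at_right 0. f t $ i \<noteq> c" if "c \<notin> F" for c
      using F(2)[OF that] pos
    proof eventually_elim
      case (elim t)
      have "t\<^sup>2 / 2 * f t $ i = eigvec (A t) $ i - eigvec X $ i - t * eig_dir1 X H $ i"
        unfolding f_component times_divide_eq_right
        using elim(2) by (intro nonzero_mult_div_cancel_left) simp
      then show ?case using elim(1) by auto
    qed
    show ?thesis
      by (rule tendsto_of_eventually_avoiding[OF cont bound F(1) avoid], assumption, rule exI)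
  qed
  then obtain L where "\<forall>i. ((\<lambda>t. f t $ i) \<longlongrightarrow> L i) (at_right 0)"
    using choice[of "\<lambda>i l. ((\<lambda>t. f t $ i) \<longlongrightarrow> l) (at_right 0)"] by blast
  then have "(f \<longlongrightarrow> (\<chi> i. L i)) (at_right 0)"
    by (intro vec_tendstoI) simp
  then show ?thesis
    unfolding eig_dir2_def f_def[symmetric] A_def[symmetric] by (simp add: tendsto_Lim)
qed

text \<open>By the Lipschitz bound, replacing \<open>W\<close> by \<open>V k\<close> changes the
  quotient by at most a multiple of \<open>norm (V k - W)\<close>. The arbitrary filter covers both
  sequences and arcs.\<close>

lemma eig_dir2_expansion:
  fixes X H W :: "real^'n::{finite,linorder}^'n::{finite,linorder}"
  assumes X: "X \<in> sym_mats" and H: "H \<in> sym_mats" and W: "W \<in> sym_mats"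
    and t: "filterlim t (at_right 0) F" and V: "(V \<longlongrightarrow> W) F" and Vsym: "\<forall>\<^sub>F k in F. V k \<in> sym_mats"
  shows "((\<lambda>k. (1 / ((t k)\<^sup>2 / 2)) *\<^sub>R
      (eigvec (X + t k *\<^sub>R H + ((t k)\<^sup>2 / 2) *\<^sub>R V k) - eigvec X - t k *\<^sub>R eig_dir1 X H)) \<longlongrightarrow> eig_dir2 X H W) F"
proof -
  define g where "g k = (1 / ((t k)\<^sup>2 / 2)) *\<^sub>R
      (eigvec (X + t k *\<^sub>R H + ((t k)\<^sup>2 / 2) *\<^sub>R W) - eigvec X - t k *\<^sub>R eig_dir1 X H)" for k
  define f where "f k = (1 / ((t k)\<^sup>2 / 2)) *\<^sub>R
      (eigvec (X + t k *\<^sub>R H + ((t k)\<^sup>2 / 2) *\<^sub>R V k) - eigvec X - t k *\<^sub>R eig_dir1 X H)" for k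
  have g: "(g \<longlongrightarrow> eig_dir2 X H W) F"
    using filterlim_compose[OF eig_dir2_tendsto[OF X H W] t] unfolding g_def .
  have pos: "\<forall>\<^sub>F k in F. 0 < t k"
    using filterlim_iff[THEN iffD1, OF t, rule_format, OF eventually_at_right_less] .
  have "((\<lambda>k. f k - g k) \<longlongrightarrow> 0) F"
  proof (rule Lim_null_comparison)
    show "\<forall>\<^sub>F k in F. norm (f k - g k) \<le> real CARD('n) * norm (V k - W)"
      using pos Vsym
    proof eventually_elim
      case (elim k)
      let ?s = "(t k)\<^sup>2 / 2"
      have "norm (eigvec (X + t k *\<^sub>R H + ?s *\<^sub>R V k) - eigvec (X + t k *\<^sub>R H + ?s *\<^sub>R W))
          \<le> real CARD('n) * norm ((X + t k *\<^sub>R H + ?s *\<^sub>R V k) - (X + t k *\<^sub>R H + ?s *\<^sub>R W))"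
        using elim X H W by (intro eigvec_lipschitz sym_mats_add sym_mats_scaleR)
      also have "(X + t k *\<^sub>R H + ?s *\<^sub>R V k) - (X + t k *\<^sub>R H + ?s *\<^sub>R W) = ?s *\<^sub>R (V k - W)"
        by (simp add: scaleR_diff_right)
      finally have le: "norm (eigvec (X + t k *\<^sub>R H + ?s *\<^sub>R V k) - eigvec (X + t k *\<^sub>R H + ?s *\<^sub>R W))
          \<le> real CARD('n) * norm (V k - W) * ?s"
        by (simp add: mult_ac)
      have "f k - g k = (1 / ?s) *\<^sub>R (eigvec (X + t k *\<^sub>R H + ?s *\<^sub>R V k) - eigvec (X + t k *\<^sub>R H + ?s *\<^sub>R W))"
        by (simp add: f_def g_def flip: scaleR_diff_right)
      then have "norm (f k - g k) = norm (eigvec (X + t k *\<^sub>R H + ?s *\<^sub>R V k) - eigvec (X + t k *\<^sub>R H + ?s *\<^sub>R W)) / ?s"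
        by simp
      also have "\<dots> \<le> real CARD('n) * norm (V k - W)"
        using elim(1) by (subst pos_divide_le_eq) (simp, rule le)
      finally show ?case .
    qed
    have "((\<lambda>k. norm (V k - W)) \<longlongrightarrow> 0) F"
      using V by (simp add: LIM_zero tendsto_norm_zero)
    then show "((\<lambda>k. real CARD('n) * norm (V k - W)) \<longlongrightarrow> 0) F"
      by (rule tendsto_mult_right_zero)
  qed
  from tendsto_add[OF this g] show ?thesis by (simp add: f_def)
qed

section \<open>Spectral sets\<close>

lemma perm_symmetric_permute_iff:
  assumes "perm_symmetric \<Theta>" "\<sigma> permutes UNIV"
  shows "(\<chi> i. x $ \<sigma> i) \<in> \<Theta> \<longleftrightarrow> x \<in> \<Theta>"
proof
  assume "(\<chi> i. x $ \<sigma> i) \<in> \<Theta>"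
  then have "(\<chi> i. (\<chi> i. x $ \<sigma> i) $ inv \<sigma> i) \<in> \<Theta>"
    using assms permutes_inv unfolding perm_symmetric_def by blast
  then show "x \<in> \<Theta>"
    using permutes_inverses(1)[OF assms(2)] by simp
qed (use assms in \<open>auto simp: perm_symmetric_def\<close>)

lemma eigvec_spec_mem_iff:
  fixes U :: "real^'n::{finite,linorder}^'n::{finite,linorder}"
  assumes "perm_symmetric \<Theta>" "orthogonal_matrix U"
  shows "eigvec (spec U d) \<in> \<Theta> \<longleftrightarrow> d \<in> \<Theta>"
  using eigvec_spec_permutes[OF assms(2)] perm_symmetric_permute_iff[OF assms(1)] by metis

text \<open>\<open>Z\<close> is \<open>spec U d\<close> with the eigenvectors \<open>U\<close> of
  \<open>Y\<close>; this is the passage from \<Theta> to \<open>C\<close>.\<close>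

lemma spectral_set_projection:
  fixes Y :: "real^'n::{finite,linorder}^'n::{finite,linorder}"
  assumes "perm_symmetric \<Theta>" "Y \<in> sym_mats" "d \<in> \<Theta>"
  obtains Z where "Z \<in> sym_mats" "eigvec Z \<in> \<Theta>"
    "norm (Z - Y) \<le> real CARD('n) ^ 3 * norm (d - eigvec Y)"
proof -
  obtain U where U: "orthogonal_matrix U" "Y = spec U (eigvec Y)"
    using spectral_theorem[OF assms(2)] .
  have "spec U d - Y = spec U (d - eigvec Y)"
    using U(2) by (simp add: spec_diff)
  then show thesis
    using norm_spec_le[OF U(1)] eigvec_spec_mem_iff[OF assms(1) U(1)] assms(3)
    by (intro that[of "spec U d"] spec_in_sym_mats) simp_all
qed

text \<open>The passage from \<open>C\<close> to \<Theta>, for an unsorted \<open>d\<close>: the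
  eigenvalues of \<open>A\<close> are rearranged by the inverse of the permutation that sorts
  \<open>d\<close>, which preserves both norms and membership in \<Theta>.\<close>

lemma spectral_set_eigenvalue_projection:
  fixes U A :: "real^'n::{finite,linorder}^'n::{finite,linorder}"
  assumes "perm_symmetric \<Theta>" "orthogonal_matrix U" "A \<in> sym_mats" "eigvec A \<in> \<Theta>"
  obtains d' where "d' \<in> \<Theta>" "norm (d' - d) \<le> real CARD('n) * norm (A - spec U d)"
proof -
  obtain \<sigma> where \<sigma>: "\<sigma> permutes UNIV" "eigvec (spec U d) = (\<chi> i. d $ \<sigma> i)"
    using eigvec_spec_permutes[OF assms(2)] .
  define d' where "d' = (\<chi> i. eigvec A $ inv \<sigma> i)"
  have "(\<chi> i. (d' - d) $ \<sigma> i) = eigvec A - eigvec (spec U d)"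
    using permutes_inverses(2)[OF \<sigma>(1)] by (simp add: d'_def \<sigma>(2) vec_eq_iff)
  then have "norm (eigvec A - eigvec (spec U d)) = norm (\<chi> i. (d' - d) $ \<sigma> i)"
    by simp
  also have "\<dots> = norm (d' - d)"
    using sum.permute[OF \<sigma>(1), of "\<lambda>i. (norm ((d' - d) $ i))\<^sup>2"]
    by (simp add: norm_vec_def L2_set_def o_def)
  finally have "norm (d' - d) \<le> real CARD('n) * norm (A - spec U d)"
    using eigvec_lipschitz[OF assms(3) spec_in_sym_mats[of U d]] by simp
  moreover have "d' \<in> \<Theta>"
    unfolding d'_def using perm_symmetric_permute_iff[OF assms(1) permutes_inv[OF \<sigma>(1)]] assms(4) by blast
  ultimately show thesis by (rule that[rotated])
qed

lemma spec_tendsto: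
  fixes U :: "real^'n^'n"
  assumes "orthogonal_matrix U" "(d \<longlongrightarrow> l) F"
  shows "((\<lambda>k. spec U (d k)) \<longlongrightarrow> spec U l) F"
proof (rule Lim_null_comparison[THEN LIM_zero_cancel])
  show "\<forall>\<^sub>F k in F. norm (spec U (d k) - spec U l) \<le> real CARD('n) ^ 3 * norm (d k - l)"
    using norm_spec_le[OF assms(1)] by (simp flip: spec_diff)
  show "((\<lambda>k. real CARD('n) ^ 3 * norm (d k - l)) \<longlongrightarrow> 0) F"
    using tendsto_mult_right_zero[OF tendsto_norm_zero[OF LIM_zero[OF assms(2)]]] .
qed

section \<open>Second-order tangent sets and parabolic arcs\<close>

lemma second_tangent_nonempty_of_bounded:
  fixes V :: "nat \<Rightarrow> 'a::euclidean_space"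
  assumes t: "\<forall>k. t k > 0" "t \<longlonglongrightarrow> 0" and "bounded (range V)"
    and mem: "\<And>k. x + t k *\<^sub>R w + (t k ^ 2 / 2) *\<^sub>R V k \<in> C"
  shows "second_tangent C x w \<noteq> {}"
proof -
  obtain W r where r: "strict_mono r" "(V \<circ> r) \<longlonglongrightarrow> W"
    using bounded_imp_convergent_subsequence[OF assms(3)] by blast
  then have "W \<in> second_tangent C x w"
    unfolding second_tangent_def mem_Collect_eq
    using t(1) mem LIMSEQ_subseq_LIMSEQ[OF t(2) r(1)]
    by (intro exI[of _ "t \<circ> r"] exI[of _ "V \<circ> r"]) simp
  then show ?thesis by blast
qed

text \<open>Together with \<open>parabolically_derivableD\<close> this trades an arc for its
  rescaled second-order remainder \<open>V\<close>, so that arcs and sequences are treated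
  alike.\<close>

lemma parabolic_arc_of_remainder:
  assumes "x \<in> C" "0 < \<epsilon>" and V: "(V \<longlongrightarrow> u) (at_right 0)"
    and mem: "\<And>t. 0 < t \<Longrightarrow> t \<le> \<epsilon> \<Longrightarrow> x + t *\<^sub>R w + (t\<^sup>2 / 2) *\<^sub>R V t \<in> C"
  shows "\<exists>\<epsilon>>0. \<exists>\<xi>::real \<Rightarrow> 'a::real_normed_vector. (\<forall>t\<in>{0..\<epsilon>}. \<xi> t \<in> C) \<and> \<xi> 0 = x \<and>
    ((\<lambda>t. (1 / t) *\<^sub>R (\<xi> t - \<xi> 0)) \<longlongrightarrow> w) (at_right 0) \<and>
    ((\<lambda>t. (1 / (t ^ 2 / 2)) *\<^sub>R (\<xi> t - \<xi> 0 - t *\<^sub>R w)) \<longlongrightarrow> u) (at_right 0)"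
proof -
  define \<xi> where "\<xi> t = x + t *\<^sub>R w + (t\<^sup>2 / 2) *\<^sub>R V t" for t :: real
  have \<xi>0: "\<xi> 0 = x" by (simp add: \<xi>_def)
  have pos: "\<forall>\<^sub>F t::real in at_right 0. 0 < t" by (rule eventually_at_right_less)
  have eq: "\<forall>\<^sub>F t in at_right 0. w + (t / 2) *\<^sub>R V t = (1 / t) *\<^sub>R (\<xi> t - \<xi> 0)"
    using pos by eventually_elim (simp add: \<xi>_def scaleR_add_right power2_eq_square)
  have "((\<lambda>t. w + (t / 2) *\<^sub>R V t) \<longlongrightarrow> w + (0 / 2) *\<^sub>R u) (at_right 0)"
    by (intro tendsto_intros V) simp
  then have "((\<lambda>t. (1 / t) *\<^sub>R (\<xi> t - \<xi> 0)) \<longlongrightarrow> w) (at_right 0)"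
    using Lim_transform_eventually[OF _ eq] by simp
  moreover have "\<forall>\<^sub>F t in at_right 0. V t = (1 / (t ^ 2 / 2)) *\<^sub>R (\<xi> t - \<xi> 0 - t *\<^sub>R w)"
    using pos by eventually_elim (simp add: \<xi>_def)
  then have "((\<lambda>t. (1 / (t ^ 2 / 2)) *\<^sub>R (\<xi> t - \<xi> 0 - t *\<^sub>R w)) \<longlongrightarrow> u) (at_right 0)"
    using V by (rule tendsto_cong[THEN iffD1])
  moreover have "\<xi> t \<in> C" if "t \<in> {0..\<epsilon>}" for t
    using mem[of t] that \<xi>0 assms(1) by (cases "t = 0") (auto simp: \<xi>_def)
  ultimately show ?thesis using assms(2) \<xi>0 by blast
qed

lemma parabolically_derivableD:
  assumes "parabolically_derivable C x w" "u \<in> second_tangent C x w"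
  obtains \<epsilon> V where "0 < \<epsilon>" "(V \<longlongrightarrow> u) (at_right 0)"
    "\<And>t. 0 < t \<Longrightarrow> t \<le> \<epsilon> \<Longrightarrow> x + t *\<^sub>R w + (t\<^sup>2 / 2) *\<^sub>R V t \<in> C"
proof -
  obtain \<epsilon> and \<xi> :: "real \<Rightarrow> 'a" where \<xi>: "0 < \<epsilon>" "\<forall>t\<in>{0..\<epsilon>}. \<xi> t \<in> C" "\<xi> 0 = x"
    "((\<lambda>t. (1 / (t ^ 2 / 2)) *\<^sub>R (\<xi> t - \<xi> 0 - t *\<^sub>R w)) \<longlongrightarrow> u) (at_right 0)"
    using assms unfolding parabolically_derivable_def by blast
  show thesis
  proof (rule that[OF \<xi>(1,4)])
    fix t :: real assume "0 < t" "t \<le> \<epsilon>"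
    then have "x + t *\<^sub>R w + (t\<^sup>2 / 2) *\<^sub>R (1 / (t ^ 2 / 2)) *\<^sub>R (\<xi> t - \<xi> 0 - t *\<^sub>R w) = \<xi> t"
      using \<xi>(3) by simp
    then show "x + t *\<^sub>R w + (t\<^sup>2 / 2) *\<^sub>R (1 / (t ^ 2 / 2)) *\<^sub>R (\<xi> t - \<xi> 0 - t *\<^sub>R w) \<in> C"
      using \<xi>(2) \<open>0 < t\<close> \<open>t \<le> \<epsilon>\<close> by simp
  qed
qed

lemma filterlim_at_right_0_of_pos:
  fixes t :: "'a \<Rightarrow> real"
  assumes "(t \<longlongrightarrow> 0) F" "\<forall>\<^sub>F k in F. t k > 0"
  shows "filterlim t (at_right 0) F"
  using assms by (simp add: tendsto_imp_filterlim_at_right)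

lemma sym_mats_parabola_coefficient:
  assumes "X \<in> sym_mats" "H \<in> sym_mats" "X + t *\<^sub>R H + s *\<^sub>R V \<in> sym_mats" "s \<noteq> 0"
  shows "V \<in> sym_mats"
proof -
  have "(1 / s) *\<^sub>R ((X + t *\<^sub>R H + s *\<^sub>R V) - X - t *\<^sub>R H) \<in> sym_mats"
    using assms(1-3) by (intro sym_mats_scaleR sym_mats_diff)
  then show ?thesis using assms(4) by simp
qed

lemma second_tangent_in_sym_mats:
  fixes C :: "(real^'n^'n) set"
  assumes "C \<subseteq> sym_mats" "X \<in> sym_mats" "H \<in> sym_mats" "W \<in> second_tangent C X H"
  shows "W \<in> sym_mats"
proof -
  obtain t V where t: "\<forall>k. t k > 0" and V: "V \<longlonglongrightarrow> W"
    and mem: "\<forall>k. X + t k *\<^sub>R H + (t k ^ 2 / 2) *\<^sub>R V k \<in> C"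
    using assms(4) unfolding second_tangent_def by blast
  have "V k \<in> sym_mats" for k
  proof (rule sym_mats_parabola_coefficient[OF assms(2,3)])
    show "X + t k *\<^sub>R H + (t k ^ 2 / 2) *\<^sub>R V k \<in> sym_mats"
      using mem assms(1) by blast
    show "t k ^ 2 / 2 \<noteq> 0"
      using t[rule_format, of k] by simp
  qed
  then show ?thesis
    using closed_sequentially[OF closed_sym_mats _ V] by blast
qed

lemma tangent_cone_in_sym_mats:
  fixes C :: "(real^'n^'n) set"
  assumes "C \<subseteq> sym_mats" "X \<in> sym_mats" "H \<in> tangent_cone C X"
  shows "H \<in> sym_mats"
proof -
  obtain t V where t: "\<forall>k. t k > 0" and V: "V \<longlonglongrightarrow> H" and mem: "\<forall>k. X + t k *\<^sub>R V k \<in> C"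
    using assms(3) unfolding tangent_cone_def by blast
  have "V k \<in> sym_mats" for k
  \<comment> \<open>The parabola degenerates to a line: \<open>X\<close> fills the place of
    \<open>H\<close> with coefficient 0.\<close>
  proof (rule sym_mats_parabola_coefficient[OF assms(2) assms(2)])
    show "X + 0 *\<^sub>R X + t k *\<^sub>R V k \<in> sym_mats"
      using mem assms(1) by auto
    show "t k \<noteq> 0"
      using t[rule_format, of k] by simp
  qed
  then show ?thesis
    using closed_sequentially[OF closed_sym_mats _ V] by blast
qed

section \<open>Transfer between \<Theta> and \<open>C\<close> at a fixed point\<close>

locale spectral_set =
  fixes \<Theta> :: "(real^'n::{finite,linorder}) set"
    and C :: "(real^'n::{finite,linorder}^'n::{finite,linorder}) set"
    and X :: "real^'n::{finite,linorder}^'n::{finite,linorder}"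
  assumes perm: "perm_symmetric \<Theta>"
    and C_eq: "C = {Y \<in> sym_mats. eigvec Y \<in> \<Theta>}"
    and X_in: "X \<in> C"
begin

lemma C_sym: "C \<subseteq> sym_mats" and X_sym: "X \<in> sym_mats"
  using C_eq X_in by auto

text \<open>The second-order quotients of the eigenvalues along the witnessing sequence are
  themselves witnesses for \<Theta>.\<close>

lemma eig_dir2_in_second_tangent:
  assumes H: "H \<in> sym_mats" and W: "W \<in> second_tangent C X H"
  shows "eig_dir2 X H W \<in> second_tangent \<Theta> (eigvec X) (eig_dir1 X H)"
proof -
  have Wsym: "W \<in> sym_mats"
    using second_tangent_in_sym_mats[OF C_sym X_sym H W] .
  obtain t V where t: "\<forall>k. t k > 0" "t \<longlonglongrightarrow> 0" and V: "V \<longlonglongrightarrow> W"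
    and mem: "\<forall>k. X + t k *\<^sub>R H + (t k ^ 2 / 2) *\<^sub>R V k \<in> C"
    using W unfolding second_tangent_def by blast
  define u where "u k = (1 / ((t k)\<^sup>2 / 2)) *\<^sub>R
      (eigvec (X + t k *\<^sub>R H + ((t k)\<^sup>2 / 2) *\<^sub>R V k) - eigvec X - t k *\<^sub>R eig_dir1 X H)" for k
  have Vsym: "V k \<in> sym_mats" for k
  proof (rule sym_mats_parabola_coefficient[OF X_sym H])
    show "X + t k *\<^sub>R H + (t k ^ 2 / 2) *\<^sub>R V k \<in> sym_mats"
      using mem C_sym by blast
    show "t k ^ 2 / 2 \<noteq> 0"
      using t(1)[rule_format, of k] by simp
  qed
  have "u \<longlonglongrightarrow> eig_dir2 X H W"
    unfolding u_def using t V Vsym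
    by (intro eig_dir2_expansion X_sym H Wsym filterlim_at_right_0_of_pos) auto
  moreover have "eigvec X + t k *\<^sub>R eig_dir1 X H + ((t k)\<^sup>2 / 2) *\<^sub>R u k \<in> \<Theta>" for k
  proof -
    have "((t k)\<^sup>2 / 2) *\<^sub>R u k = eigvec (X + t k *\<^sub>R H + ((t k)\<^sup>2 / 2) *\<^sub>R V k) - eigvec X - t k *\<^sub>R eig_dir1 X H"
      using t(1)[rule_format, of k] by (simp add: u_def)
    then show ?thesis using mem C_eq by auto
  qed
  ultimately show ?thesis
    using t unfolding second_tangent_def by blast
qed

text \<open>The eigenvalues along the parabola with coefficient \<open>W\<close> and the prescribed
  points of \<Theta> differ by \<open>s k\<close> times \<open>u k - q k\<close>, which tends to 0.
  Replacing the spectrum moves the matrix by a comparable amount.\<close>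

lemma lift_to_spectral_set:
  assumes H: "H \<in> sym_mats" and W: "W \<in> sym_mats"
    and t: "filterlim t (at_right 0) F" and u: "(u \<longlongrightarrow> eig_dir2 X H W) F"
  obtains V where "(V \<longlongrightarrow> W) F"
    "\<And>k. 0 < t k \<Longrightarrow> eigvec X + t k *\<^sub>R eig_dir1 X H + ((t k)\<^sup>2 / 2) *\<^sub>R u k \<in> \<Theta> \<Longrightarrow>
       X + t k *\<^sub>R H + ((t k)\<^sup>2 / 2) *\<^sub>R V k \<in> C"
proof -
  define s where "s k = (t k)\<^sup>2 / 2" for k
  define \<theta> where "\<theta> k = eigvec X + t k *\<^sub>R eig_dir1 X H + s k *\<^sub>R u k" for k
  define Y where "Y k = X + t k *\<^sub>R H + s k *\<^sub>R W" for k
  define q where "q k = (1 / s k) *\<^sub>R (eigvec (Y k) - eigvec X - t k *\<^sub>R eig_dir1 X H)" for k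
  have Y: "Y k \<in> sym_mats" for k
    unfolding Y_def using X_sym H W by (intro sym_mats_add sym_mats_scaleR)
  \<comment> \<open>Membership is conditional so that a choice exists for every \<open>k\<close>;
    \<open>Y k\<close> itself is the default when \<theta> \<open>k\<close> is outside
    \<Theta>.\<close>
  have "\<exists>Z. (\<theta> k \<in> \<Theta> \<longrightarrow> Z \<in> C) \<and> norm (Z - Y k) \<le> real CARD('n) ^ 3 * norm (\<theta> k - eigvec (Y k))" for k
  proof (cases "\<theta> k \<in> \<Theta>")
    case True
    then obtain Z where "Z \<in> sym_mats" "eigvec Z \<in> \<Theta>"
      "norm (Z - Y k) \<le> real CARD('n) ^ 3 * norm (\<theta> k - eigvec (Y k))"
      using spectral_set_projection[OF perm Y] by blast
    then show ?thesis using C_eq by blast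
  qed (intro exI[of _ "Y k"], simp)
  then obtain Z where Z: "\<And>k. \<theta> k \<in> \<Theta> \<Longrightarrow> Z k \<in> C"
    "\<And>k. norm (Z k - Y k) \<le> real CARD('n) ^ 3 * norm (\<theta> k - eigvec (Y k))"
    by metis
  define V where "V k = (1 / s k) *\<^sub>R (Z k - X - t k *\<^sub>R H)" for k
  have pos: "\<forall>\<^sub>F k in F. 0 < t k"
    using filterlim_iff[THEN iffD1, OF t, rule_format, OF eventually_at_right_less] .
  have q: "(q \<longlongrightarrow> eig_dir2 X H W) F"
    unfolding q_def Y_def s_def
    by (rule eig_dir2_expansion[OF X_sym H W t tendsto_const]) (simp add: W)
  have "((\<lambda>k. V k - W) \<longlongrightarrow> 0) F"
  proof (rule Lim_null_comparison)
    show "\<forall>\<^sub>F k in F. norm (V k - W) \<le> real CARD('n) ^ 3 * norm (u k - q k)"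
      using pos
    proof eventually_elim
      case (elim k)
      then have s: "s k > 0" by (simp add: s_def)
      have "V k - W = (1 / s k) *\<^sub>R (Z k - Y k)"
        using s by (simp add: V_def Y_def algebra_simps)
      then have "norm (V k - W) = (1 / s k) * norm (Z k - Y k)"
        using s by simp
      also have "\<dots> \<le> (1 / s k) * (real CARD('n) ^ 3 * norm (\<theta> k - eigvec (Y k)))"
        using Z(2) s by (intro mult_left_mono) auto
      also have "\<dots> = real CARD('n) ^ 3 * norm ((1 / s k) *\<^sub>R (\<theta> k - eigvec (Y k)))"
        using s by simp
      also have "(1 / s k) *\<^sub>R (\<theta> k - eigvec (Y k)) = u k - q k"
        using s by (simp add: q_def \<theta>_def algebra_simps)
      finally show ?case .
    qed
    have "((\<lambda>k. norm (u k - q k)) \<longlongrightarrow> 0) F"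
      using tendsto_norm[OF tendsto_diff[OF u q]] by simp
    then show "((\<lambda>k. real CARD('n) ^ 3 * norm (u k - q k)) \<longlongrightarrow> 0) F"
      by (rule tendsto_mult_right_zero)
  qed
  then have V: "(V \<longlongrightarrow> W) F" by (rule LIM_zero_cancel)
  show thesis
  proof (rule that[OF V])
    fix k assume "0 < t k" "eigvec X + t k *\<^sub>R eig_dir1 X H + ((t k)\<^sup>2 / 2) *\<^sub>R u k \<in> \<Theta>"
    then have "Z k \<in> C" "s k \<noteq> 0" using Z(1) by (simp_all add: \<theta>_def s_def)
    then show "X + t k *\<^sub>R H + ((t k)\<^sup>2 / 2) *\<^sub>R V k \<in> C"
      unfolding s_def[symmetric] by (simp add: V_def)
  qed
qed

lemma second_tangent_spectral_set:
  assumes H: "H \<in> sym_mats"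
  shows "second_tangent C X H = {W \<in> sym_mats. eig_dir2 X H W \<in> second_tangent \<Theta> (eigvec X) (eig_dir1 X H)}"
proof (intro equalityI subsetI CollectI conjI; (elim CollectE conjE)?)
  fix W assume W: "W \<in> second_tangent C X H"
  show "W \<in> sym_mats" using second_tangent_in_sym_mats[OF C_sym X_sym H W] .
  show "eig_dir2 X H W \<in> second_tangent \<Theta> (eigvec X) (eig_dir1 X H)"
    using eig_dir2_in_second_tangent[OF H W] .
next
  fix W assume W: "W \<in> sym_mats" and "eig_dir2 X H W \<in> second_tangent \<Theta> (eigvec X) (eig_dir1 X H)"
  then obtain t u where t: "\<forall>k. t k > 0" "t \<longlonglongrightarrow> 0" and u: "u \<longlonglongrightarrow> eig_dir2 X H W"
    and mem: "\<forall>k. eigvec X + t k *\<^sub>R eig_dir1 X H + (t k ^ 2 / 2) *\<^sub>R u k \<in> \<Theta>"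
    unfolding second_tangent_def by blast
  have "filterlim t (at_right 0) sequentially"
    using t by (intro filterlim_at_right_0_of_pos) auto
  then obtain V where "V \<longlonglongrightarrow> W" "\<And>k. X + t k *\<^sub>R H + ((t k)\<^sup>2 / 2) *\<^sub>R V k \<in> C"
    using lift_to_spectral_set[OF H W _ u] t mem by metis
  with t show "W \<in> second_tangent C X H"
    unfolding second_tangent_def by blast
qed

text \<open>No \<open>W\<close> with \<open>eig_dir2 X H W = u0\<close> is at hand, so the
  comparison is with \<open>X + t H\<close>. The remainder is then only O(t^2), and compactness
  supplies a limit.\<close>

lemma second_tangent_spectral_set_nonempty:
  assumes H: "H \<in> sym_mats" and "u0 \<in> second_tangent \<Theta> (eigvec X) (eig_dir1 X H)"
  shows "second_tangent C X H \<noteq> {}"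
proof -
  obtain t u where t: "\<forall>k. t k > 0" "t \<longlonglongrightarrow> 0" and u: "u \<longlonglongrightarrow> u0"
    and mem: "\<forall>k. eigvec X + t k *\<^sub>R eig_dir1 X H + (t k ^ 2 / 2) *\<^sub>R u k \<in> \<Theta>"
    using assms(2) unfolding second_tangent_def by blast
  define s where "s k = (t k)\<^sup>2 / 2" for k
  have s: "s k > 0" for k using t(1)[rule_format, of k] by (simp add: s_def)
  define \<theta> where "\<theta> k = eigvec X + t k *\<^sub>R eig_dir1 X H + s k *\<^sub>R u k" for k
  define Y where "Y k = X + t k *\<^sub>R H" for k
  define q where "q k = (1 / s k) *\<^sub>R (eigvec (Y k) - eigvec X - t k *\<^sub>R eig_dir1 X H)" for k
  have "Y k \<in> sym_mats" for k
    unfolding Y_def using X_sym H by (intro sym_mats_add sym_mats_scaleR)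
  then have "\<exists>Z \<in> C. norm (Z - Y k) \<le> real CARD('n) ^ 3 * norm (\<theta> k - eigvec (Y k))" for k
    using spectral_set_projection[OF perm, of "Y k" "\<theta> k"] mem unfolding C_eq \<theta>_def s_def
    by (metis (mono_tags, lifting) mem_Collect_eq)
  then obtain Z where Z: "\<And>k. Z k \<in> C"
    "\<And>k. norm (Z k - Y k) \<le> real CARD('n) ^ 3 * norm (\<theta> k - eigvec (Y k))"
    by metis
  define V where "V k = (1 / s k) *\<^sub>R (Z k - Y k)" for k
  have le: "norm (V k) \<le> real CARD('n) ^ 3 * norm (u k - q k)" for k
  proof -
    have "(1 / s k) *\<^sub>R (\<theta> k - eigvec (Y k)) = u k - q k"
      using s[of k] by (simp add: q_def \<theta>_def algebra_simps)
    then have "norm (u k - q k) = (1 / s k) * norm (\<theta> k - eigvec (Y k))"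
      using s[of k] by (metis norm_scaleR abs_of_pos zero_less_divide_1_iff)
    moreover have "norm (V k) = (1 / s k) * norm (Z k - Y k)"
      using s[of k] by (simp add: V_def)
    ultimately show ?thesis
      using mult_left_mono[OF Z(2)[of k], of "1 / s k"] s[of k] by (simp add: mult_ac)
  qed
  have "filterlim t (at_right 0) sequentially"
    using t by (intro filterlim_at_right_0_of_pos) auto
  \<comment> \<open>The second-order expansion with \<open>W = 0\<close> makes \<open>q\<close>, and
    hence the rescaled remainder \<open>V\<close>, bounded.\<close>
  then have "q \<longlonglongrightarrow> eig_dir2 X H 0"
    using eig_dir2_expansion[OF X_sym H, of 0 t sequentially "\<lambda>_. 0"]
    by (simp add: q_def[abs_def] Y_def s_def sym_mats_def transpose_def vec_eq_iff)
  then have "(\<lambda>k. real CARD('n) ^ 3 * norm (u k - q k)) \<longlonglongrightarrow> real CARD('n) ^ 3 * norm (u0 - eig_dir2 X H 0)"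
    by (intro tendsto_intros u)
  then have "Bseq (\<lambda>k. real CARD('n) ^ 3 * norm (u k - q k))"
    by (rule convergent_imp_Bseq[OF convergentI])
  then obtain B where "\<forall>k. norm (real CARD('n) ^ 3 * norm (u k - q k)) \<le> B"
    unfolding Bseq_def by blast
  then have "norm (V k) \<le> B" for k
    using order_trans[OF le[of k]] by (metis abs_ge_self order_trans real_norm_def)
  then have "bounded (range V)"
    by (auto intro: boundedI)
  moreover have "X + t k *\<^sub>R H + ((t k)\<^sup>2 / 2) *\<^sub>R V k \<in> C" for k
  proof -
    have "X + t k *\<^sub>R H + s k *\<^sub>R V k = Z k"
      using s[of k] by (simp add: V_def Y_def)
    then show ?thesis using Z(1)[of k] by (simp add: s_def)
  qed
  ultimately show ?thesis
    by (intro second_tangent_nonempty_of_bounded[OF t])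
qed

lemma parabolically_derivable_lift:
  assumes "H \<in> tangent_cone C X" and pd: "parabolically_derivable \<Theta> (eigvec X) (eig_dir1 X H)"
  shows "parabolically_derivable C X H"
  unfolding parabolically_derivable_def
proof (intro conjI ballI)
  have H: "H \<in> sym_mats"
    using tangent_cone_in_sym_mats[OF C_sym X_sym assms(1)] .
  show "H \<in> tangent_cone C X" by fact
  show "second_tangent C X H \<noteq> {}"
    using pd second_tangent_spectral_set_nonempty[OF H] unfolding parabolically_derivable_def by blast
  fix W assume "W \<in> second_tangent C X H"
  then have W: "W \<in> sym_mats" "eig_dir2 X H W \<in> second_tangent \<Theta> (eigvec X) (eig_dir1 X H)"
    unfolding second_tangent_spectral_set[OF H] by auto
  obtain \<epsilon> u where \<epsilon>: "0 < \<epsilon>" and u: "(u \<longlongrightarrow> eig_dir2 X H W) (at_right 0)"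
    and mem: "\<And>t. 0 < t \<Longrightarrow> t \<le> \<epsilon> \<Longrightarrow> eigvec X + t *\<^sub>R eig_dir1 X H + (t\<^sup>2 / 2) *\<^sub>R u t \<in> \<Theta>"
    using parabolically_derivableD[OF pd W(2)] by blast
  obtain V where V: "(V \<longlongrightarrow> W) (at_right 0)"
    "\<And>t. 0 < t \<Longrightarrow> eigvec X + t *\<^sub>R eig_dir1 X H + (t\<^sup>2 / 2) *\<^sub>R u t \<in> \<Theta> \<Longrightarrow>
       X + t *\<^sub>R H + (t\<^sup>2 / 2) *\<^sub>R V t \<in> C"
    using lift_to_spectral_set[OF H W(1) filterlim_ident u] by blast
  show "\<exists>\<epsilon>>0. \<exists>\<xi>. (\<forall>t\<in>{0..\<epsilon>}. \<xi> t \<in> C) \<and> \<xi> 0 = X \<and>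
      ((\<lambda>t. (1 / t) *\<^sub>R (\<xi> t - \<xi> 0)) \<longlongrightarrow> H) (at_right 0) \<and>
      ((\<lambda>t. (1 / (t ^ 2 / 2)) *\<^sub>R (\<xi> t - \<xi> 0 - t *\<^sub>R H)) \<longlongrightarrow> W) (at_right 0)"
    using mem V(2) by (intro parabolic_arc_of_remainder[OF X_in \<epsilon> V(1)]) blast
qed

text \<open>With the eigenvectors \<open>U\<close> of \<open>X\<close>, the map
  \<open>spec U\<close> embeds \<Theta> linearly into \<open>C\<close>. Tangent data of \<Theta> are
  pushed forward by it and pulled back by \<open>project\<close>, without sorting \<open>v\<close>
  or using \<open>eig_dir1\<close>.\<close>

lemma parabolically_derivable_descend:
  assumes "\<forall>H \<in> tangent_cone C X. parabolically_derivable C X H" and v: "v \<in> tangent_cone \<Theta> (eigvec X)"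
  shows "parabolically_derivable \<Theta> (eigvec X) v"
  unfolding parabolically_derivable_def
proof (intro conjI ballI)
  show "v \<in> tangent_cone \<Theta> (eigvec X)" by fact
  obtain U where U: "orthogonal_matrix U" and XU: "X = spec U (eigvec X)"
    using spectral_theorem[OF X_sym] .
  have specC: "spec U d \<in> C \<longleftrightarrow> d \<in> \<Theta>" for d
    using eigvec_spec_mem_iff[OF perm U] spec_in_sym_mats C_eq by blast
  have line: "spec U (eigvec X + t *\<^sub>R d) = X + t *\<^sub>R spec U d" for t d
    using XU by (simp add: spec_add spec_scaleR)
  define H where "H = spec U v"
  have "H \<in> tangent_cone C X"
  proof -
    obtain t vk where "\<forall>k. t k > 0" "t \<longlonglongrightarrow> 0" "vk \<longlonglongrightarrow> v" and mem: "\<forall>k. eigvec X + t k *\<^sub>R vk k \<in> \<Theta>"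
      using v unfolding tangent_cone_def by blast
    moreover have "\<forall>k. X + t k *\<^sub>R spec U (vk k) \<in> C"
      using mem by (simp add: specC flip: line)
    ultimately show ?thesis
      unfolding tangent_cone_def H_def using spec_tendsto[OF U] by blast
  qed
  then have pd: "parabolically_derivable C X H" using assms(1) by blast
  have project: "\<exists>d'\<in>\<Theta>. norm (d' - d) \<le> real CARD('n) * norm (A - spec U d)" if "A \<in> C" for A d
    using spectral_set_eigenvalue_projection[OF perm U, of A d] that C_eq by blast
  \<comment> \<open>Points of \<open>C\<close> at distance O(t^2) from \<open>X + t H\<close>
    project to points of \<Theta> at distance O(t^2) from \<open>eigvec X + t v\<close>; compactness
    again gives a limit.\<close>
  show "second_tangent \<Theta> (eigvec X) v \<noteq> {}"
  proof -
    obtain W where "W \<in> second_tangent C X H"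
      using pd unfolding parabolically_derivable_def by blast
    then obtain t V where t: "\<forall>k. t k > 0" "t \<longlonglongrightarrow> 0" and V: "V \<longlonglongrightarrow> W"
      and mem: "\<forall>k. X + t k *\<^sub>R H + (t k ^ 2 / 2) *\<^sub>R V k \<in> C"
      unfolding second_tangent_def by blast
    have "\<exists>d'\<in>\<Theta>. norm (d' - (eigvec X + t k *\<^sub>R v)) \<le> real CARD('n) * norm ((t k ^ 2 / 2) *\<^sub>R V k)" for k
      using project[OF mem[rule_format, of k], of "eigvec X + t k *\<^sub>R v"] by (simp add: line H_def)
    then obtain d where d: "\<And>k. d k \<in> \<Theta>"
      "\<And>k. norm (d k - (eigvec X + t k *\<^sub>R v)) \<le> real CARD('n) * norm ((t k ^ 2 / 2) *\<^sub>R V k)"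
      by metis
    define u where "u k = (1 / (t k ^ 2 / 2)) *\<^sub>R (d k - (eigvec X + t k *\<^sub>R v))" for k
    have "bounded (range V)"
      using V convergent_imp_bounded by blast
    then obtain B where B: "\<And>k. norm (V k) \<le> B"
      by (auto simp: bounded_iff)
    have "norm (u k) \<le> real CARD('n) * B" for k
    proof -
      have "norm (u k) = (1 / (t k ^ 2 / 2)) * norm (d k - (eigvec X + t k *\<^sub>R v))"
        by (simp add: u_def)
      also have "\<dots> \<le> (1 / (t k ^ 2 / 2)) * (real CARD('n) * norm ((t k ^ 2 / 2) *\<^sub>R V k))"
        by (intro mult_left_mono d(2)) simp
      also have "\<dots> = real CARD('n) * norm (V k)"
        using t(1)[rule_format, of k] by simp
      also have "\<dots> \<le> real CARD('n) * B"
        using B by (intro mult_left_mono) auto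
      finally show ?thesis .
    qed
    then have "bounded (range u)" by (auto intro: boundedI)
    moreover have "eigvec X + t k *\<^sub>R v + (t k ^ 2 / 2) *\<^sub>R u k \<in> \<Theta>" for k
      using d(1)[of k] t(1)[rule_format, of k] by (simp add: u_def)
    ultimately show ?thesis
      by (intro second_tangent_nonempty_of_bounded[OF t])
  qed
  fix u assume "u \<in> second_tangent \<Theta> (eigvec X) v"
  then obtain t uk where t: "\<forall>k. t k > 0" "t \<longlonglongrightarrow> 0" and uk: "uk \<longlonglongrightarrow> u"
    and mem: "\<forall>k. eigvec X + t k *\<^sub>R v + (t k ^ 2 / 2) *\<^sub>R uk k \<in> \<Theta>"
    unfolding second_tangent_def by blast
  have parabola: "spec U (eigvec X + t *\<^sub>R v + s *\<^sub>R d) = X + t *\<^sub>R H + s *\<^sub>R spec U d" for t s d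
    using line[of t v] by (simp add: spec_add spec_scaleR H_def)
  have "\<forall>k. X + t k *\<^sub>R H + (t k ^ 2 / 2) *\<^sub>R spec U (uk k) \<in> C"
    using mem by (simp add: specC flip: parabola)
  then have "spec U u \<in> second_tangent C X H"
    unfolding second_tangent_def using t spec_tendsto[OF U uk] by blast
  then obtain \<epsilon> V where \<epsilon>: "0 < \<epsilon>" and V: "(V \<longlongrightarrow> spec U u) (at_right 0)"
    and memC: "\<And>t. 0 < t \<Longrightarrow> t \<le> \<epsilon> \<Longrightarrow> X + t *\<^sub>R H + (t\<^sup>2 / 2) *\<^sub>R V t \<in> C"
    using parabolically_derivableD[OF pd] by blast
  \<comment> \<open>The arc in \<open>C\<close> has second-order coefficient
    \<open>spec U u\<close>; comparing it with the image of the parabola for \<open>u\<close> leaves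
    an error o(t^2) after projection to \<Theta>.\<close>
  have "\<exists>d'. 0 < t \<and> t \<le> \<epsilon> \<longrightarrow> d' \<in> \<Theta> \<and>
      norm (d' - (eigvec X + t *\<^sub>R v + (t\<^sup>2 / 2) *\<^sub>R u)) \<le> real CARD('n) * norm ((t\<^sup>2 / 2) *\<^sub>R (V t - spec U u))" for t
    using project[OF memC[of t], of "eigvec X + t *\<^sub>R v + (t\<^sup>2 / 2) *\<^sub>R u"]
    by (auto simp: parabola scaleR_diff_right)
  then obtain d where d: "\<And>t. 0 < t \<Longrightarrow> t \<le> \<epsilon> \<Longrightarrow> d t \<in> \<Theta>"
    "\<And>t. 0 < t \<Longrightarrow> t \<le> \<epsilon> \<Longrightarrow> norm (d t - (eigvec X + t *\<^sub>R v + (t\<^sup>2 / 2) *\<^sub>R u))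
       \<le> real CARD('n) * norm ((t\<^sup>2 / 2) *\<^sub>R (V t - spec U u))"
    by metis
  define w where "w t = (1 / (t\<^sup>2 / 2)) *\<^sub>R (d t - (eigvec X + t *\<^sub>R v))" for t
  have "(w \<longlongrightarrow> u) (at_right 0)"
  proof (rule Lim_null_comparison[THEN LIM_zero_cancel])
    have "\<forall>\<^sub>F t::real in at_right 0. 0 < t \<and> t \<le> \<epsilon>"
      using \<epsilon> by (auto simp: eventually_at_right_field intro!: exI[of _ \<epsilon>])
    then show "\<forall>\<^sub>F t in at_right 0. norm (w t - u) \<le> real CARD('n) * norm (V t - spec U u)"
    proof eventually_elim
      case (elim t)
      then have "w t - u = (1 / (t\<^sup>2 / 2)) *\<^sub>R (d t - (eigvec X + t *\<^sub>R v + (t\<^sup>2 / 2) *\<^sub>R u))"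
        by (simp add: w_def algebra_simps)
      then have "norm (w t - u) = (1 / (t\<^sup>2 / 2)) * norm (d t - (eigvec X + t *\<^sub>R v + (t\<^sup>2 / 2) *\<^sub>R u))"
        by simp
      also have "\<dots> \<le> (1 / (t\<^sup>2 / 2)) * (real CARD('n) * norm ((t\<^sup>2 / 2) *\<^sub>R (V t - spec U u)))"
        using elim d(2) by (intro mult_left_mono) auto
      also have "\<dots> = real CARD('n) * norm (V t - spec U u)"
        using elim by simp
      finally show ?case .
    qed
    show "((\<lambda>t. real CARD('n) * norm (V t - spec U u)) \<longlongrightarrow> 0) (at_right 0)"
      using tendsto_mult_right_zero[OF tendsto_norm_zero[OF LIM_zero[OF V]]] .
  qed
  moreover have "eigvec X + t *\<^sub>R v + (t\<^sup>2 / 2) *\<^sub>R w t \<in> \<Theta>" if "0 < t" "t \<le> \<epsilon>" for t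
    using d(1)[OF that] that by (simp add: w_def)
  moreover have "eigvec X \<in> \<Theta>" using X_in C_eq by blast
  ultimately show "\<exists>\<epsilon>>0. \<exists>\<xi>. (\<forall>t\<in>{0..\<epsilon>}. \<xi> t \<in> \<Theta>) \<and> \<xi> 0 = eigvec X \<and>
      ((\<lambda>t. (1 / t) *\<^sub>R (\<xi> t - \<xi> 0)) \<longlongrightarrow> v) (at_right 0) \<and>
      ((\<lambda>t. (1 / (t ^ 2 / 2)) *\<^sub>R (\<xi> t - \<xi> 0 - t *\<^sub>R v)) \<longlongrightarrow> u) (at_right 0)"
    using parabolic_arc_of_remainder[OF _ \<epsilon>] by blast
qed

end

theorem theorem4p3:
  fixes \<Theta> :: "(real^'n::{finite,linorder}) set"
    and C :: "(real^'n::{finite,linorder}^'n::{finite,linorder}) set"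
    and X H :: "real^'n::{finite,linorder}^'n::{finite,linorder}"
  assumes "perm_symmetric \<Theta>"
    and "C = {Y \<in> sym_mats. eigvec Y \<in> \<Theta>}"
    and "X \<in> C"
    and "H \<in> tangent_cone C X"
  shows "second_tangent C X H =
           {W \<in> sym_mats. eig_dir2 X H W \<in> second_tangent \<Theta> (eigvec X) (eig_dir1 X H)}
         \<and> (parabolically_derivable \<Theta> (eigvec X) (eig_dir1 X H) \<longrightarrow> parabolically_derivable C X H)
         \<and> ((\<forall>H' \<in> tangent_cone C X. parabolically_derivable C X H') \<longrightarrow>
              (\<forall>v \<in> tangent_cone \<Theta> (eigvec X). parabolically_derivable \<Theta> (eigvec X) v))"
proof -
  interpret spectral_set \<Theta> C X
    using assms(1-3) by unfold_locales
  have "H \<in> sym_mats"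
    using tangent_cone_in_sym_mats[OF C_sym X_sym assms(4)] .
  then show ?thesis
    using second_tangent_spectral_set parabolically_derivable_lift[OF assms(4)] parabolically_derivable_descend
    by blast
qed

end
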